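(* (A-posteriori error bound.) Let $\mu\in\mathcal{D}$ and let $m_a(\mu)>0$ be a monotonicity constant of the quasilinear form $a$, i.e. $$a[v](v,v-w;\mu)-a[w](w,v-w;\mu)\ \ge\ m_a(\mu)\,\|v-w\|_V^2\qquad\text{for all } v,w\in V.$$ Let $u_\delta(\mu)\in\mathcal{X}_\delta$ be the truth solution and $u_N(\mu)\in\mathcal{X}_{\triangle t,N}$ the reduced basis solution (both defined in the context), and assume that $u_\delta^0:=u_\delta(0)\in V_N$. Then the error $e(\mu)=u_\delta(\mu)-u_N(\mu)$ of the reduced basis approximation is bounded by $$\|e(\mu)\|_{\mathcal{Y}}\ \le\ \frac{1}{m_a(\mu)}\Big(\|R(\cdot;\mu)\|_{\mathcal{Y}'}+\delta_M(\mu)\,\|u_N(\mu)\|_{L^2(I;V)}\Big)=:\triangle_{N,M}(\mu),$$ where $R(\cdot;\mu)\in\mathcal{Y}'$ is the residual defined in the context and $$\delta_M(\mu)=\sup_{t\in I}\ \sup_{x\in\Omega}\big|\nu_M(u_N(x,t);\mu)-\nu(u_N(x,t);\mu)\big|$$ denotes the approximation error of the nonlinearity.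
   Context: **Spaces.** $\Omega\subset\mathbb{R}^d$ is the spatial domain, $\mathcal{D}\subset\mathbb{R}^p$ is a compact parameter set, $I=(0,T]$. $V\subset H^1(\Omega)$ is a separable Hilbert space, $H=L^2(\Omega)$, and $V\hookrightarrow H\hookrightarrow V'$ is the associated Gelfand triple with duality pairing $\langle\cdot,\cdot\rangle_{V'V}$ and $\|l\|_{V'}=\sup_{0\ne\psi\in V}\langle l,\psi\rangle_{V'V}/\|\psi\|_V$. The trial space is $\mathcal{X}=L^2(I;V)\cap H^1(I;V')$ with $\|w\|_{\mathcal{X}}^2=\|\dot w\|_{L^2(I;V')}^2+\|w\|_{L^2(I;V)}^2$; it embeds into $C(I;H)$, so that $w(0)\in H$ is well defined. The test space is $\mathcal{Y}=L^2(I;V)\times H$ with $\|v\|_{\mathcal{Y}}^2=\|v^{(1)}\|_{L^2(I;V)}^2+\|v^{(2)}\|_H^2$ for $v=(v^{(1)},v^{(2)})$, and $\mathcal{Y}'$ is its dual with the dual norm. For $w\in\mathcal{X}$, $\|w\|_{\mathcal{Y}}$ means $\|w\|_{\mathcal{Y}}^2=\|w\|_{L^2(I;V)}^2+\|w(0)\|_H^2$. **Exact problem.** For $\mu\in\mathcal{D}$ let $\nu(\cdot;\mu)\in C^1(\mathbb{R})$ and $$a[u](w,v;\mu)=\int_\Omega \nu(u(x);\mu)\,\nabla w\cdot\nabla v\,dx,\qquad \langle A(u,\mu),v\rangle_{V'V}=a[u](u,v;\mu),$$ where $A:V\times\mathcal{D}\to V'$ is a bounded quasilinear differential operator. The form is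 assumed strongly monotone on $V$ with constant $m_a(\mu)>0$ (the inequality displayed in the claim) and Lipschitz continuous, $|a[u](u,v;\mu)-a[w](w,v;\mu)|\le L_a(\mu)\|u-w\|_V\|v\|_V$ for all $u,v,w\in V$, with $\inf_{\mu\in\mathcal{D}}m_a(\mu)>0$ and $\sup_{\mu\in\mathcal{D}}L_a(\mu)<\infty$. Given $(g(\cdot;\mu),u_o)\in L^2(I;V')\times H$, set for $u\in\mathcal{X}$, $v\in\mathcal{Y}$ $$B[u](u,v;\mu)=\int_I \langle\dot u,v^{(1)}\rangle_{V'V}+a[u](u,v^{(1)};\mu)\,dt+\langle u(0),v^{(2)}\rangle_H,$$ $$F(v;\mu)=\int_I\langle g(\mu),v^{(1)}\rangle_{V'V}\,dt+\langle u_o,v^{(2)}\rangle_H .$$ The exact problem is to find $u(\mu)\in\mathcal{X}$ with $B[u](u,v;\mu)=F(v;\mu)$ for all $v\in\mathcal{Y}$; it has a unique solution. **Truth solution.** Let $0=t^0<\dots<t^K=T$, $I^k=(t^{k-1},t^k]$, and let $V_h\subset V$ be a finite-dimensional subspace. Let $$\mathcal{X}_\delta=\{w\in C^0(I;V): w|_{I^k}\in\mathcal{P}_1(I^k,V_h),\ k=1,\dots,K\},$$ $$\mathcal{Y}_\delta=\{w\in L^2(I;V): w|_{I^k}\in\mathcal{P}_0(I^k,V_h),\ k=1,\dots,K\}\times V_h,$$ where $\mathcal{P}_j(I^k,W)$ denotes the $W$-valued polynomials in time of degree at most $j$ on $I^k$; so $\mathcal{X}_\delta\subset\mathcal{X}$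 and $\mathcal{Y}_\delta\subset\mathcal{Y}$. The truth solution $u_\delta=u_\delta(\mu)\in\mathcal{X}_\delta$ is the unique solution of $u_\delta^0:=u_\delta(0)=P_H^hu_o$ and $$B[u_\delta](u_\delta,v_\delta;\mu)=F(v_\delta;\mu)\quad\text{for all }v_\delta\in\mathcal{Y}_\delta,$$ where $P_H^h:H\to V_h$ is the $H$-orthogonal projection. Write $u_\delta^k=u_\delta(t^k)$. It is assumed that the exact solution can be approximated arbitrarily well by the truth solution, and the corresponding approximation error is neglected (errors are measured against the truth solution). **Empirical interpolation (EIM) of $\nu$.** Functions $q_1,\dots,q_M$ on $\Omega$ and points $x_1^M,\dots,x_M^M\in\Omega$ are constructed greedily, with $\nu_0:=0$. For $m=1,\dots,M$, choose $(\mu_m^\nu,k_m)$ as a maximizer of $\|\nu(u_\delta^k(\cdot;\mu');\mu')-\nu_{m-1}(u_\delta^k(\cdot;\mu');\mu')\|_{L^\infty(\Omega)}$ over $(\mu',k)\in\mathcal{D}\times\{1,\dots,K\}$; let $r_m(x)=\nu(u_\delta^{k_m}(x;\mu_m^\nu);\mu_m^\nu)-\nu_{m-1}(u_\delta^{k_m}(x;\mu_m^\nu);\mu_m^\nu)$, let $x_m^M$ be a maximizer of $|r_m|$ over $\Omega$, and put $q_m=r_m/r_m(x_m^M)$. Here $\nu_m$ is the interpolant built from the first $m$ functions and points. The EIM approximation of $\nu(w(x);\mu)$, applied at each time to $w=u_\delta$ or $w=u_N$, is $$\nu_M(w(x);\mu)=\sum_{m=1}^M\big(\mathbf{B}_M^{-1}\nu_\mu\big)_m\,q_m(x),\qquad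 \nu_\mu=\big(\nu(w(x_m^M);\mu)\big)_{m=1}^M,\quad (\mathbf{B}_M)_{ij}=q_j(x_i^M),$$ where $\mathbf{B}_M$ is lower triangular with unit diagonal. The approximate form is $$\tilde a[w](w,v;\mu)=\int_\Omega \nu_M(w(x);\mu)\,\nabla w\cdot\nabla v\,dx .$$ It is assumed that the EIM approximation is sufficiently accurate that $\tilde a$ is strongly monotone with constant $\tilde m_a(\mu)=m_a(\mu)-\epsilon_a>0$, where $\epsilon_a>0$ is small enough and related to the EIM approximation error. **Reduced basis solution.** Let $V_N\subset V_h$ be a low-dimensional subspace (in practice produced by a POD-Greedy procedure), and let $\mathcal{X}_{\triangle t,N}$, $\mathcal{Y}_{\triangle t,N}$ be defined as $\mathcal{X}_\delta$, $\mathcal{Y}_\delta$ with $V_h$ replaced by $V_N$. Let $P_H^N:V_h\to V_N$ be the $H$-orthogonal projection. The reduced basis solution $u_N=u_N(\mu)\in\mathcal{X}_{\triangle t,N}$ is the unique solution of $u_N(0)=P_H^Nu_\delta^0$ and $$\tilde B[u_N](u_N,v_N;\mu)=\int_I\langle g(\mu),v_N^{(1)}\rangle_{V'V}\,dt+\langle u_\delta^0,v_N^{(2)}\rangle_H\quad\text{for all }v_N\in\mathcal{Y}_{\triangle t,N},$$ where $$\tilde B[u_N](u_N,v;\mu)=\int_I\langle\dot u_N,v^{(1)}\rangle_{V'V}+\tilde a[u_N](u_N,v^{(1)};\mu)\,dt+\langle u_N(0),v^{(2)}\rangle_H .$$ **Residual.** $R(\cdot;\mu)\in\mathcal{Y}'$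 denotes the residual, defined by $$R(v;\mu):=F(v;\mu)-\tilde B[u_N](u_N,v;\mu)=\int_I\langle r(t;\mu),v^{(1)}\rangle_{V'V}\,dt\quad\text{for all }v\in\mathcal{Y}_\delta,$$ where $\langle r(t;\mu),\psi\rangle_{V'V}=\langle g(t;\mu),\psi\rangle_{V'V}-\langle\dot u_N(t),\psi\rangle_{V'V}-\tilde a[u_N(t)](u_N(t),\psi;\mu)$ for $\psi\in V$ (the initial-value terms cancel on $\mathcal{Y}_\delta$ when $u_\delta^0\in V_N$). $\|R(\cdot;\mu)\|_{\mathcal{Y}'}$ is its norm in the dual of $\mathcal{Y}$.
   Formalization: "Truth error neglected" is made a hypothesis: u_δ satisfies the exact solution's equation for all tests in L²(I;V_h)×V_h, not only Y_δ (otherwise the bound can fail for large time steps); the norm of V is taken to dominate the L² norm of the gradient with constant one. *)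

theory Defs
  imports "HOL-Analysis.Analysis" "HOL-Probability.Essential_Supremum"
begin

section \<open>Square integrable functions\<close>

text \<open>
  Elements of Lebesgue and Bochner spaces are represented by functions; functions that agree
  almost everywhere stand for the same element.
\<close>

definition L2_space :: "'a measure \<Rightarrow> ('a \<Rightarrow> 'b::real_normed_vector) set" where
  "L2_space M = {f \<in> borel_measurable M. integrable M (\<lambda>x. (norm (f x))\<^sup>2)}"

definition L2_norm :: "'a measure \<Rightarrow> ('a \<Rightarrow> 'b::real_normed_vector) \<Rightarrow> real" where
  "L2_norm M f = sqrt (LINT x|M. (norm (f x))\<^sup>2)"

definition L2_inner :: "'a measure \<Rightarrow> ('a \<Rightarrow> real) \<Rightarrow> ('a \<Rightarrow> real) \<Rightarrow> real" where
  "L2_inner M f g = (LINT x|M. f x * g x)"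

text \<open>The essential supremum of the modulus, with value \<open>\<infinity>\<close> outside of the space.\<close>

definition Linf_norm :: "'a measure \<Rightarrow> ('a \<Rightarrow> real) \<Rightarrow> ereal" where
  "Linf_norm M f = esssup M (\<lambda>x. ereal \<bar>f x\<bar>)"


section \<open>The space \<open>V\<close> as a subspace of \<open>H\<^sup>1(\<Omega>)\<close>\<close>

text \<open>
  Test functions for weak derivatives: continuously differentiable with compact support in the
  open set \<open>S\<close>. By mollification, smooth test functions give the same weak derivatives.
\<close>

definition test_functions :: "'a::euclidean_space set \<Rightarrow> ('a \<Rightarrow> real) set" where
  "test_functions S = {\<phi>. (\<forall>x. \<phi> differentiable (at x)) \<and>
     (\<forall>b\<in>Basis. continuous_on UNIV (\<lambda>x. frechet_derivative \<phi> (at x) b)) \<and>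
     (\<exists>C. compact C \<and> C \<subseteq> S \<and> (\<forall>x. x \<notin> C \<longrightarrow> \<phi> x = 0))}"

definition weak_gradient ::
  "(real^'d) set \<Rightarrow> (real^'d \<Rightarrow> real) \<Rightarrow> (real^'d \<Rightarrow> real^'d) \<Rightarrow> bool" where
  "weak_gradient \<Omega> f G \<longleftrightarrow> (\<forall>\<phi>\<in>test_functions \<Omega>. \<forall>i.
     (LINT x|lebesgue_on \<Omega>. f x * frechet_derivative \<phi> (at x) (axis i 1)) =
     - (LINT x|lebesgue_on \<Omega>. G x $ i * \<phi> x))"

text \<open>
  The separable Hilbert space \<open>V\<close> is the universe of the type \<open>'v\<close>. An element \<open>v\<close> is, as a member of
  \<open>H\<^sup>1(\<Omega>)\<close>, the function \<open>val v\<close> with weak gradient \<open>grad v\<close>. This is a continuous linear embedding,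
  with dense range in \<open>H = L\<^sup>2(\<Omega>)\<close> (Gelfand triple). The norm of \<open>V\<close> is an arbitrary Hilbert norm
  that dominates the gradient seminorm with constant one, such as the full \<open>H\<^sup>1\<close> norm, or
  the gradient norm itself where Poincare's inequality is available.
\<close>

definition H1_subspace ::
  "(real^'d) set \<Rightarrow> ('v::{real_inner,banach,second_countable_topology} \<Rightarrow> real^'d \<Rightarrow> real)
    \<Rightarrow> ('v \<Rightarrow> real^'d \<Rightarrow> real^'d) \<Rightarrow> bool" where
  "H1_subspace \<Omega> val grad \<longleftrightarrow>
     (\<forall>v. val v \<in> L2_space (lebesgue_on \<Omega>) \<and> grad v \<in> L2_space (lebesgue_on \<Omega>) \<and>
          weak_gradient \<Omega> (val v) (grad v)) \<and>
     (\<forall>v w a b. AE x in lebesgue_on \<Omega>.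
          val (a *\<^sub>R v + b *\<^sub>R w) x = a * val v x + b * val w x \<and>
          grad (a *\<^sub>R v + b *\<^sub>R w) x = a *\<^sub>R grad v x + b *\<^sub>R grad w x) \<and>
     (\<forall>v. (AE x in lebesgue_on \<Omega>. val v x = 0) \<longrightarrow> v = 0) \<and>
     (\<exists>C. \<forall>v. L2_norm (lebesgue_on \<Omega>) (val v) \<le> C * norm v) \<and>
     (\<forall>v. L2_norm (lebesgue_on \<Omega>) (grad v) \<le> norm v) \<and>
     (\<forall>f\<in>L2_space (lebesgue_on \<Omega>). \<forall>\<epsilon>>0. \<exists>v.
          L2_norm (lebesgue_on \<Omega>) (\<lambda>x. f x - val v x) < \<epsilon>)"

text \<open>
  A finite-dimensional subspace of \<open>V\<close>. Its elements have point values (needed for the empirical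
  interpolation), so here \<open>val\<close> is linear at every point of \<open>\<Omega>\<close>.
\<close>

definition discrete_space ::
  "(real^'d) set \<Rightarrow> ('v::real_vector \<Rightarrow> real^'d \<Rightarrow> real) \<Rightarrow> 'v set \<Rightarrow> bool" where
  "discrete_space \<Omega> val W \<longleftrightarrow> subspace W \<and> (\<exists>B. finite B \<and> span B = W) \<and>
     (\<forall>v\<in>W. \<forall>w\<in>W. \<forall>a b. \<forall>x\<in>\<Omega>. val (a *\<^sub>R v + b *\<^sub>R w) x = a * val v x + b * val w x)"

text \<open>The \<open>H\<close>-orthogonal projection onto \<open>W\<close>.\<close>

definition H_proj ::
  "(real^'d) set \<Rightarrow> ('v \<Rightarrow> real^'d \<Rightarrow> real) \<Rightarrow> 'v set \<Rightarrow> (real^'d \<Rightarrow> real) \<Rightarrow> 'v" where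
  "H_proj \<Omega> val W f = (THE p. p \<in> W \<and>
     (\<forall>w\<in>W. L2_inner (lebesgue_on \<Omega>) (\<lambda>x. f x - val p x) (val w) = 0))"


section \<open>Trial and test spaces\<close>

abbreviation time_measure :: "real \<Rightarrow> real measure" where
  "time_measure T \<equiv> lebesgue_on {0<..T}"

text \<open>
  The dual \<open>V'\<close> is the type of bounded linear functionals on \<open>'v\<close>, with the operator norm. As
  \<open>V'\<close> is separable, Borel measurability is strong measurability there, and \<open>L2_space\<close> is the
  Bochner space. The derivative of \<open>w\<close> is taken in \<open>V'\<close>, where \<open>w(t)\<close> acts as the functional \<open>(w(t), \<cdot>)\<^sub>H\<close>.
\<close>

definition weak_time_deriv ::
  "(real^'d) set \<Rightarrow> real \<Rightarrow> ('v::real_normed_vector \<Rightarrow> real^'d \<Rightarrow> real)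
    \<Rightarrow> (real \<Rightarrow> 'v) \<Rightarrow> (real \<Rightarrow> 'v \<Rightarrow>\<^sub>L real) \<Rightarrow> bool" where
  "weak_time_deriv \<Omega> T val w w' \<longleftrightarrow> w' \<in> L2_space (time_measure T) \<and>
     (\<forall>\<phi>\<in>test_functions {0<..<T}. \<forall>\<psi>.
        (LINT t|time_measure T. L2_inner (lebesgue_on \<Omega>) (val (w t)) (val \<psi>) * deriv \<phi> t) =
        - (LINT t|time_measure T. blinfun_apply (w' t) \<psi> * \<phi> t))"

definition trial_space ::
  "(real^'d) set \<Rightarrow> real \<Rightarrow> ('v::real_normed_vector \<Rightarrow> real^'d \<Rightarrow> real)
    \<Rightarrow> (real \<Rightarrow> 'v) set" where
  "trial_space \<Omega> T val = {w \<in> L2_space (time_measure T). \<exists>w'. weak_time_deriv \<Omega> T val w w'}"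

text \<open>The derivative is unique almost everywhere.\<close>

definition time_deriv ::
  "(real^'d) set \<Rightarrow> real \<Rightarrow> ('v::real_normed_vector \<Rightarrow> real^'d \<Rightarrow> real)
    \<Rightarrow> (real \<Rightarrow> 'v) \<Rightarrow> real \<Rightarrow> 'v \<Rightarrow>\<^sub>L real" where
  "time_deriv \<Omega> T val w = (SOME w'. weak_time_deriv \<Omega> T val w w')"

text \<open>
  The value \<open>w(0) \<in> H\<close> of the representative of \<open>w\<close> in \<open>C([0,T]; H)\<close>; it is unique almost everywhere.
\<close>

definition initial_value ::
  "(real^'d) set \<Rightarrow> real \<Rightarrow> ('v \<Rightarrow> real^'d \<Rightarrow> real) \<Rightarrow> (real \<Rightarrow> 'v) \<Rightarrow> real^'d \<Rightarrow> real" where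
  "initial_value \<Omega> T val w = (SOME h. \<exists>W.
     (\<forall>t\<in>{0..T}. W t \<in> L2_space (lebesgue_on \<Omega>)) \<and>
     (\<forall>t\<in>{0..T}. ((\<lambda>s. L2_norm (lebesgue_on \<Omega>) (\<lambda>x. W s x - W t x)) \<longlongrightarrow> 0)
        (at t within {0..T})) \<and>
     (AE t in time_measure T. AE x in lebesgue_on \<Omega>. W t x = val (w t) x) \<and>
     h = W 0)"

definition test_space ::
  "(real^'d) set \<Rightarrow> real \<Rightarrow> ((real \<Rightarrow> 'v::real_normed_vector) \<times> (real^'d \<Rightarrow> real)) set" where
  "test_space \<Omega> T = L2_space (time_measure T) \<times> L2_space (lebesgue_on \<Omega>)"

definition test_norm ::
  "(real^'d) set \<Rightarrow> real \<Rightarrow> (real \<Rightarrow> 'v::real_normed_vector) \<times> (real^'d \<Rightarrow> real) \<Rightarrow> real" where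
  "test_norm \<Omega> T v =
     sqrt ((L2_norm (time_measure T) (fst v))\<^sup>2 + (L2_norm (lebesgue_on \<Omega>) (snd v))\<^sup>2)"

text \<open>The norm of the test space, applied to a trial function \<open>w\<close> through the pair \<open>(w, w(0))\<close>.\<close>

definition trial_test_norm ::
  "(real^'d) set \<Rightarrow> real \<Rightarrow> ('v::real_normed_vector \<Rightarrow> real^'d \<Rightarrow> real)
    \<Rightarrow> (real \<Rightarrow> 'v) \<Rightarrow> real" where
  "trial_test_norm \<Omega> T val w = test_norm \<Omega> T (w, initial_value \<Omega> T val w)"

text \<open>
  The norm in the dual of the test space, as an extended real: a linear functional belongs to the
  dual if and only if the value is finite.
\<close>

definition test_dual_norm ::
  "(real^'d) set \<Rightarrow> real
    \<Rightarrow> ((real \<Rightarrow> 'v::real_normed_vector) \<times> (real^'d \<Rightarrow> real) \<Rightarrow> real) \<Rightarrow> ennreal" where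
  "test_dual_norm \<Omega> T R =
     (SUP v\<in>{v \<in> test_space \<Omega> T. test_norm \<Omega> T v \<noteq> 0}. ennreal (\<bar>R v\<bar> / test_norm \<Omega> T v))"

definition time_grid :: "real \<Rightarrow> nat \<Rightarrow> (nat \<Rightarrow> real) \<Rightarrow> bool" where
  "time_grid T K \<tau> \<longleftrightarrow> \<tau> 0 = 0 \<and> \<tau> K = T \<and> (\<forall>k\<in>{1..K}. \<tau> (k - 1) < \<tau> k)"

definition discrete_trial_space ::
  "real \<Rightarrow> nat \<Rightarrow> (nat \<Rightarrow> real) \<Rightarrow> 'v::real_normed_vector set \<Rightarrow> (real \<Rightarrow> 'v) set" where
  "discrete_trial_space T K \<tau> W = {w. continuous_on {0..T} w \<and>
     (\<forall>k\<in>{1..K}. \<exists>a\<in>W. \<exists>b\<in>W. \<forall>t\<in>{\<tau> (k - 1)<..\<tau> k}. w t = a + t *\<^sub>R b)}"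

definition discrete_test_space ::
  "real \<Rightarrow> ('v::real_normed_vector \<Rightarrow> real^'d \<Rightarrow> real) \<Rightarrow> nat \<Rightarrow> (nat \<Rightarrow> real)
    \<Rightarrow> 'v set \<Rightarrow> ((real \<Rightarrow> 'v) \<times> (real^'d \<Rightarrow> real)) set" where
  "discrete_test_space T val K \<tau> W =
     {v \<in> L2_space (time_measure T). \<forall>k\<in>{1..K}. \<exists>a\<in>W. \<forall>t\<in>{\<tau> (k - 1)<..\<tau> k}. v t = a}
       \<times> val ` W"

text \<open>\<open>L\<^sup>2(I; W) \<times> W\<close>: discrete in space only.\<close>

definition semidiscrete_test_space ::
  "real \<Rightarrow> ('v::real_normed_vector \<Rightarrow> real^'d \<Rightarrow> real) \<Rightarrow> 'v set
    \<Rightarrow> ((real \<Rightarrow> 'v) \<times> (real^'d \<Rightarrow> real)) set" where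
  "semidiscrete_test_space T val W =
     {v \<in> L2_space (time_measure T). \<forall>t\<in>{0<..T}. v t \<in> W} \<times> val ` W"


section \<open>Forms and problems\<close>

text \<open>
  The form \<open>a[u](w,v)\<close> with coefficient \<open>\<kappa> (val u)\<close>. The coefficient is an operator
  on functions, as the empirical interpolation of \<open>\<nu>\<close> uses values of \<open>val u\<close> at several points.
\<close>

definition quasilinear_form ::
  "(real^'d) set \<Rightarrow> ('v \<Rightarrow> real^'d \<Rightarrow> real) \<Rightarrow> ('v \<Rightarrow> real^'d \<Rightarrow> real^'d)
    \<Rightarrow> ((real^'d \<Rightarrow> real) \<Rightarrow> real^'d \<Rightarrow> real) \<Rightarrow> 'v \<Rightarrow> 'v \<Rightarrow> 'v \<Rightarrow> real" where
  "quasilinear_form \<Omega> val grad \<kappa> u w v =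
     (LINT x|lebesgue_on \<Omega>. \<kappa> (val u) x * (grad w x \<bullet> grad v x))"

definition superpose :: "(real \<Rightarrow> real) \<Rightarrow> ('x \<Rightarrow> real) \<Rightarrow> 'x \<Rightarrow> real" where
  "superpose \<nu> w x = \<nu> (w x)"

definition strongly_monotone_on ::
  "'v::real_normed_vector set \<Rightarrow> ('v \<Rightarrow> 'v \<Rightarrow> 'v \<Rightarrow> real) \<Rightarrow> real \<Rightarrow> bool" where
  "strongly_monotone_on W a m \<longleftrightarrow>
     (\<forall>v\<in>W. \<forall>w\<in>W. a v v (v - w) - a w w (v - w) \<ge> m * (norm (v - w))\<^sup>2)"

definition Lipschitz_form ::
  "('v::real_normed_vector \<Rightarrow> 'v \<Rightarrow> 'v \<Rightarrow> real) \<Rightarrow> real \<Rightarrow> bool" where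
  "Lipschitz_form a L \<longleftrightarrow> (\<forall>u v w. \<bar>a u u v - a w w v\<bar> \<le> L * norm (u - w) * norm v)"

definition B_form ::
  "(real^'d) set \<Rightarrow> real \<Rightarrow> ('v::real_normed_vector \<Rightarrow> real^'d \<Rightarrow> real)
    \<Rightarrow> ('v \<Rightarrow> 'v \<Rightarrow> 'v \<Rightarrow> real) \<Rightarrow> (real \<Rightarrow> 'v)
    \<Rightarrow> (real \<Rightarrow> 'v) \<times> (real^'d \<Rightarrow> real) \<Rightarrow> real" where
  "B_form \<Omega> T val a u v =
     (LINT t|time_measure T.
        blinfun_apply (time_deriv \<Omega> T val u t) (fst v t) + a (u t) (u t) (fst v t)) +
     L2_inner (lebesgue_on \<Omega>) (initial_value \<Omega> T val u) (snd v)"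

definition F_form ::
  "(real^'d) set \<Rightarrow> real \<Rightarrow> (real \<Rightarrow> 'v::real_normed_vector \<Rightarrow>\<^sub>L real) \<Rightarrow> (real^'d \<Rightarrow> real)
    \<Rightarrow> (real \<Rightarrow> 'v) \<times> (real^'d \<Rightarrow> real) \<Rightarrow> real" where
  "F_form \<Omega> T g u\<^sub>o v =
     (LINT t|time_measure T. blinfun_apply (g t) (fst v t)) + L2_inner (lebesgue_on \<Omega>) u\<^sub>o (snd v)"

definition exact_solution ::
  "(real^'d) set \<Rightarrow> real \<Rightarrow> ('v::real_normed_vector \<Rightarrow> real^'d \<Rightarrow> real)
    \<Rightarrow> ('v \<Rightarrow> 'v \<Rightarrow> 'v \<Rightarrow> real) \<Rightarrow> (real \<Rightarrow> 'v \<Rightarrow>\<^sub>L real) \<Rightarrow> (real^'d \<Rightarrow> real)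
    \<Rightarrow> (real \<Rightarrow> 'v) \<Rightarrow> bool" where
  "exact_solution \<Omega> T val a g u\<^sub>o u \<longleftrightarrow> u \<in> trial_space \<Omega> T val \<and>
     (\<forall>v\<in>test_space \<Omega> T. B_form \<Omega> T val a u v = F_form \<Omega> T g u\<^sub>o v)"

text \<open>
  The Petrov-Galerkin solution in the discrete spaces over \<open>W\<close>. The truth solution has form \<open>a\<close>,
  space \<open>V\<^sub>h\<close> and initial datum \<open>u\<^sub>o\<close>, and the reduced basis solution has the form with the
  interpolated coefficient, space \<open>V\<^sub>N\<close> and initial datum \<open>u\<^sub>\<delta>\<^sup>0\<close>.
\<close>

definition discrete_solution ::
  "(real^'d) set \<Rightarrow> real \<Rightarrow> ('v::real_normed_vector \<Rightarrow> real^'d \<Rightarrow> real) \<Rightarrow> nat \<Rightarrow> (nat \<Rightarrow> real)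
    \<Rightarrow> 'v set \<Rightarrow> ('v \<Rightarrow> 'v \<Rightarrow> 'v \<Rightarrow> real) \<Rightarrow> (real \<Rightarrow> 'v \<Rightarrow>\<^sub>L real) \<Rightarrow> (real^'d \<Rightarrow> real)
    \<Rightarrow> (real \<Rightarrow> 'v) \<Rightarrow> bool" where
  "discrete_solution \<Omega> T val K \<tau> W a g u\<^sub>o u \<longleftrightarrow>
     u \<in> discrete_trial_space T K \<tau> W \<and> u 0 = H_proj \<Omega> val W u\<^sub>o \<and>
     (\<forall>v\<in>discrete_test_space T val K \<tau> W. B_form \<Omega> T val a u v = F_form \<Omega> T g u\<^sub>o v)"

text \<open>
  The residual of \<open>u\<close>, for \<open>v \<in> L\<^sup>2(I; V) \<times> H\<close>. On the discrete test space it is \<open>F - B\<close> when the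
  initial-value terms cancel there; the integral formula extends it to the whole test space.
\<close>

definition residual ::
  "(real^'d) set \<Rightarrow> real \<Rightarrow> ('v::real_normed_vector \<Rightarrow> real^'d \<Rightarrow> real)
    \<Rightarrow> ('v \<Rightarrow> 'v \<Rightarrow> 'v \<Rightarrow> real) \<Rightarrow> (real \<Rightarrow> 'v \<Rightarrow>\<^sub>L real) \<Rightarrow> (real \<Rightarrow> 'v)
    \<Rightarrow> (real \<Rightarrow> 'v) \<times> (real^'d \<Rightarrow> real) \<Rightarrow> real" where
  "residual \<Omega> T val a g u v =
     (LINT t|time_measure T. blinfun_apply (g t) (fst v t)
        - blinfun_apply (time_deriv \<Omega> T val u t) (fst v t) - a (u t) (u t) (fst v t))"


section \<open>Empirical interpolation\<close>

text \<open>Matrices of size \<open>n\<close> are functions of two indices in \<open>{1..n}\<close>.\<close>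

definition inverse_mat :: "nat \<Rightarrow> (nat \<Rightarrow> nat \<Rightarrow> real) \<Rightarrow> nat \<Rightarrow> nat \<Rightarrow> real" where
  "inverse_mat n A = (SOME C. \<forall>i\<in>{1..n}. \<forall>j\<in>{1..n}.
     (\<Sum>k=1..n. A i k * C k j) = (if i = j then 1 else 0) \<and>
     (\<Sum>k=1..n. C i k * A k j) = (if i = j then 1 else 0))"

text \<open>The interpolant of \<open>f\<close> by \<open>q 1, \<dots>, q n\<close> at the points \<open>p 1, \<dots>, p n\<close>.\<close>

definition interpolant ::
  "nat \<Rightarrow> (nat \<Rightarrow> 'x \<Rightarrow> real) \<Rightarrow> (nat \<Rightarrow> 'x) \<Rightarrow> ('x \<Rightarrow> real) \<Rightarrow> 'x \<Rightarrow> real" where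
  "interpolant n q p f x =
     (\<Sum>m=1..n. (\<Sum>i=1..n. inverse_mat n (\<lambda>i j. q j (p i)) m i * f (p i)) * q m x)"

definition eim_coefficient ::
  "nat \<Rightarrow> (nat \<Rightarrow> 'x \<Rightarrow> real) \<Rightarrow> (nat \<Rightarrow> 'x) \<Rightarrow> (real \<Rightarrow> real)
    \<Rightarrow> ('x \<Rightarrow> real) \<Rightarrow> 'x \<Rightarrow> real" where
  "eim_coefficient n q p \<nu> w = interpolant n q p (superpose \<nu> w)"

text \<open>
  The functions \<open>q\<close> and points \<open>p\<close> are a possible outcome of the greedy construction from the
  snapshots \<open>u \<mu> (\<tau> k)\<close>; \<open>\<mu>s m\<close> and \<open>ks m\<close> are the maximizers of step \<open>m\<close>.
\<close>

definition eim_construction ::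
  "(real^'d) set \<Rightarrow> ('v \<Rightarrow> real^'d \<Rightarrow> real) \<Rightarrow> 'p set \<Rightarrow> ('p \<Rightarrow> real \<Rightarrow> real)
    \<Rightarrow> nat \<Rightarrow> (nat \<Rightarrow> real) \<Rightarrow> ('p \<Rightarrow> real \<Rightarrow> 'v)
    \<Rightarrow> nat \<Rightarrow> (nat \<Rightarrow> real^'d \<Rightarrow> real) \<Rightarrow> (nat \<Rightarrow> real^'d) \<Rightarrow> bool" where
  "eim_construction \<Omega> val D \<nu> K \<tau> u M q p \<longleftrightarrow>
     (let err = (\<lambda>n \<mu> k x. superpose (\<nu> \<mu>) (val (u \<mu> (\<tau> k))) x
                           - eim_coefficient n q p (\<nu> \<mu>) (val (u \<mu> (\<tau> k))) x)
      in \<exists>\<mu>s ks. \<forall>m\<in>{1..M}. \<mu>s m \<in> D \<and> ks m \<in> {1..K} \<and>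
        (\<forall>\<mu>\<in>D. \<forall>k\<in>{1..K}. Linf_norm (lebesgue_on \<Omega>) (err (m - 1) \<mu> k)
            \<le> Linf_norm (lebesgue_on \<Omega>) (err (m - 1) (\<mu>s m) (ks m))) \<and>
        (let r = err (m - 1) (\<mu>s m) (ks m)
         in p m \<in> \<Omega> \<and> (\<forall>x\<in>\<Omega>. \<bar>r x\<bar> \<le> \<bar>r (p m)\<bar>) \<and> r (p m) \<noteq> 0 \<and>
            (\<forall>x\<in>\<Omega>. q m x = r x / r (p m))))"

text \<open>
  The error of the coefficient along the trajectory \<open>u\<close>, as an extended real so that
  an unbounded error is not mistaken for a finite one.
\<close>

definition coefficient_error ::
  "(real^'d) set \<Rightarrow> real \<Rightarrow> ('v \<Rightarrow> real^'d \<Rightarrow> real)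
    \<Rightarrow> ((real^'d \<Rightarrow> real) \<Rightarrow> real^'d \<Rightarrow> real) \<Rightarrow> ((real^'d \<Rightarrow> real) \<Rightarrow> real^'d \<Rightarrow> real)
    \<Rightarrow> (real \<Rightarrow> 'v) \<Rightarrow> ennreal" where
  "coefficient_error \<Omega> T val \<kappa>' \<kappa> u =
     (SUP t\<in>{0<..T}. SUP x\<in>\<Omega>. ennreal \<bar>\<kappa>' (val (u t)) x - \<kappa> (val (u t)) x\<bar>)"

end

theory Submission
  imports Defs "HOL-Real_Asymp.Real_Asymp"
begin

text \<open>
  The error \<open>e = u\<^sub>\<delta> - u\<^sub>N\<close> is itself an admissible test function, and the bound is the energy estimate
  obtained by testing with it. As \<open>u\<^sub>N(0)\<close> is the projection of \<open>u\<^sub>\<delta>(0) \<in> V\<^sub>N\<close>, the error starts at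
  \<open>e(0) = 0\<close>, so its norm is the \<open>L\<^sup>2(I;V)\<close> norm and the initial-value terms disappear. Since the error
  of the truth solution is neglected, \<open>u\<^sub>\<delta>\<close> satisfies the equation tested with \<open>(e, 0)\<close>, and subtracting
  the terms of \<open>u\<^sub>N\<close> expresses \<open>R(e)\<close> as the time integral of \<open>\<langle>e', e\<rangle>\<close>, plus that of
  \<open>a[u\<^sub>\<delta>](u\<^sub>\<delta>,e) - a[u\<^sub>N](u\<^sub>N,e)\<close>, minus that of \<open>a_tilde[u\<^sub>N](u\<^sub>N,e) - a[u\<^sub>N](u\<^sub>N,e)\<close>.
  The first integral is half the difference of the squared \<open>H\<close> norms of \<open>e\<close> at the end points, hence
  nonnegative (\<open>energy_identity\<close>). The second is at least \<open>m\<^sub>a \<parallel>e\<parallel>\<^sup>2\<close> by strong monotonicity. The third is at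
  most \<open>\<delta>\<^sub>M \<parallel>u\<^sub>N\<parallel> \<parallel>e\<parallel>\<close> by Cauchy-Schwarz in space and in time (\<open>coefficient_error_integral\<close>), because
  the gradient seminorm is dominated by the norm of \<open>V\<close>. With \<open>|R(e)| \<le> \<parallel>R\<parallel> \<parallel>e\<parallel>\<close>
  (\<open>residual_le_dual_norm\<close>) one divides by \<open>m\<^sub>a \<parallel>e\<parallel>\<close>.

  Two points need real work. The time derivative in \<open>V'\<close> is an arbitrary choice among the weak
  derivatives, which agree only almost everywhere; to evaluate \<open>\<langle>e', e\<rangle>\<close> one must know that a weak
  derivative of a piecewise affine function acts on \<open>e\<close> like the classical one. This is a variant of the
  fundamental lemma of the calculus of variations (\<open>test_functions_determine_integral\<close>), transferred to
  \<open>V'\<close> by expanding \<open>e(t)\<close> in an orthonormal basis of \<open>V\<^sub>h\<close> (\<open>weak_time_deriv_pairing\<close>). And the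
  identity for \<open>R(e)\<close> can be split into its terms only if each is integrable in time: for \<open>a\<close> this follows from the
  Lipschitz condition, for \<open>a_tilde\<close> from the fact that the interpolated coefficient is a combination of
  fixed bounded functions \<open>q\<^sub>m\<close> whose weights are continuous functions of finitely many point values.
\<close>

section \<open>Cauchy-Schwarz for square integrable functions\<close>

lemma L2_spaceD:
  assumes "f \<in> L2_space M"
  shows "f \<in> borel_measurable M" "integrable M (\<lambda>x. (norm (f x))\<^sup>2)"
  using assms by (auto simp: L2_space_def)

lemma L2_norm_nonneg: "0 \<le> L2_norm M f"
  by (simp add: L2_norm_def)

lemma L2_norm_power2: "(L2_norm M f)\<^sup>2 = (LINT x|M. (norm (f x))\<^sup>2)"
  by (simp add: L2_norm_def)

lemma L2_norm_eq_0_AE: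
  assumes "f \<in> L2_space M" "L2_norm M f = 0"
  shows "AE x in M. f x = 0"
proof -
  have "(LINT x|M. (norm (f x))\<^sup>2) = 0"
    using L2_norm_power2[of M f] assms(2) by simp
  then have "AE x in M. (norm (f x))\<^sup>2 = 0"
    using L2_spaceD(2)[OF assms(1)] by (subst (asm) integral_nonneg_eq_0_iff_AE) auto
  then show ?thesis by simp
qed

lemma L2_norm_cong_AE:
  assumes "f \<in> borel_measurable M" "g \<in> borel_measurable M" "AE x in M. f x = g x"
  shows "L2_norm M f = L2_norm M g"
proof -
  have "(LINT x|M. (norm (f x))\<^sup>2) = (LINT x|M. (norm (g x))\<^sup>2)"
    by (rule integral_cong_AE) (use assms in auto)
  then show ?thesis by (simp add: L2_norm_def)
qed

lemma integrable_norm_mult_L2: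
  assumes f: "f \<in> L2_space M" and g: "g \<in> L2_space M"
  shows "integrable M (\<lambda>x. norm (f x) * norm (g x))"
proof (rule Bochner_Integration.integrable_bound)
  show "integrable M (\<lambda>x. (norm (f x))\<^sup>2 + (norm (g x))\<^sup>2)"
    using L2_spaceD[OF f] L2_spaceD[OF g] by auto
  show "(\<lambda>x. norm (f x) * norm (g x)) \<in> borel_measurable M"
    using L2_spaceD[OF f] L2_spaceD[OF g] by auto
  have "norm a * norm b \<le> (norm a)\<^sup>2 + (norm b)\<^sup>2" for a :: 'b and b :: 'c
  proof -
    have "2 * norm a * norm b \<le> (norm a)\<^sup>2 + (norm b)\<^sup>2" by (rule sum_squares_bound)
    moreover have "0 \<le> norm a * norm b" by simp
    ultimately show ?thesis by linarith
  qed
  then show "AE x in M. norm (norm (f x) * norm (g x)) \<le> norm ((norm (f x))\<^sup>2 + (norm (g x))\<^sup>2)"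
    by auto
qed

text \<open>
  The discriminant argument: the integral of \<open>(s \<parallel>f\<parallel> - \<parallel>g\<parallel>)\<^sup>2\<close> is a nonnegative quadratic polynomial in
  \<open>s\<close>.
\<close>
lemma L2_Cauchy_Schwarz:
  assumes f: "f \<in> L2_space M" and g: "g \<in> L2_space M"
  shows "(LINT x|M. norm (f x) * norm (g x)) \<le> L2_norm M f * L2_norm M g"
proof -
  define A B P where "A = (LINT x|M. (norm (f x))\<^sup>2)" "B = (LINT x|M. (norm (g x))\<^sup>2)"
    "P = (LINT x|M. norm (f x) * norm (g x))"
  have quad: "0 \<le> s\<^sup>2 * A - 2 * s * P + B" for s
  proof -
    have "0 \<le> (LINT x|M. (s * norm (f x) - norm (g x))\<^sup>2)" by simp
    also have "\<dots> = (LINT x|M. s\<^sup>2 * (norm (f x))\<^sup>2 - 2 * s * (norm (f x) * norm (g x)) + (norm (g x))\<^sup>2)"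
      by (rule Bochner_Integration.integral_cong) (auto simp: power2_eq_square algebra_simps)
    also have "\<dots> = s\<^sup>2 * A - 2 * s * P + B"
      using L2_spaceD[OF f] L2_spaceD[OF g] integrable_norm_mult_L2[OF f g]
      by (simp add: A_B_P_def)
    finally show ?thesis .
  qed
  \<comment> \<open>The polynomial is evaluated at its minimum \<open>P / A\<close>; if \<open>A = 0\<close> it is affine, and a nonnegative
      affine function has slope zero.\<close>
  have "P\<^sup>2 \<le> A * B"
  proof (cases "A = 0")
    case True
    have "P = 0"
    proof (rule ccontr)
      assume "P \<noteq> 0"
      with quad[of "(B + 1) / (2 * P)"] True show False by simp
    qed
    then show ?thesis using True by simp
  next
    case False
    have "0 \<le> A" by (simp add: A_B_P_def)
    with False have "0 < A" by simp
    have "0 \<le> (P / A)\<^sup>2 * A - 2 * (P / A) * P + B" by (rule quad)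
    also have "\<dots> = B - P\<^sup>2 / A" using \<open>0 < A\<close> by (simp add: power2_eq_square field_simps)
    finally show ?thesis using \<open>0 < A\<close> by (simp add: field_simps)
  qed
  then have "P \<le> sqrt (A * B)" by (rule real_le_rsqrt)
  then show ?thesis by (simp add: A_B_P_def L2_norm_def real_sqrt_mult)
qed

text \<open>
  The form in which Cauchy-Schwarz is used throughout: \<open>F\<close> may be a weighted inner product of gradients, a
  duality pairing in time, or a difference of forms along trajectories.
\<close>
lemma L2_dominated_product:
  fixes F :: "'a \<Rightarrow> real"
  assumes f: "f \<in> L2_space M" and g: "g \<in> L2_space M" and F: "F \<in> borel_measurable M"
    and c: "0 \<le> c"
    and bound: "\<And>x. x \<in> space M \<Longrightarrow> \<bar>F x\<bar> \<le> c * (norm (f x) * norm (g x))"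
  shows "integrable M F" "\<bar>LINT x|M. F x\<bar> \<le> c * (L2_norm M f * L2_norm M g)"
proof -
  have int: "integrable M (\<lambda>x. c * (norm (f x) * norm (g x)))"
    using integrable_norm_mult_L2[OF f g] by simp
  show F': "integrable M F"
    by (rule Bochner_Integration.integrable_bound[OF int F])
       (rule AE_I2, use bound c in \<open>simp add: abs_mult\<close>)
  have "\<bar>LINT x|M. F x\<bar> \<le> (LINT x|M. \<bar>F x\<bar>)" by (rule integral_abs_bound)
  also have "\<dots> \<le> (LINT x|M. c * (norm (f x) * norm (g x)))"
    by (rule integral_mono) (use F' int bound in auto)
  also have "\<dots> = c * (LINT x|M. norm (f x) * norm (g x))" by simp
  also have "\<dots> \<le> c * (L2_norm M f * L2_norm M g)"
    using L2_Cauchy_Schwarz[OF f g] c by (rule mult_left_mono)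
  finally show "\<bar>LINT x|M. F x\<bar> \<le> c * (L2_norm M f * L2_norm M g)" .
qed

lemma ennreal_bound_divide:
  assumes "ennreal (m * E\<^sup>2) \<le> X * ennreal E" "0 < m" "0 < E"
  shows "ennreal E \<le> ennreal (1 / m) * X"
proof -
  have "ennreal E = ennreal (1 / (m * E)) * ennreal (m * E\<^sup>2)"
    using assms(2,3) by (simp add: ennreal_mult[symmetric] power2_eq_square)
  also have "\<dots> \<le> ennreal (1 / (m * E)) * (X * ennreal E)"
    by (rule mult_left_mono[OF assms(1)]) simp
  also have "\<dots> = (ennreal (1 / (m * E)) * ennreal E) * X" by (simp add: mult_ac)
  also have "ennreal (1 / (m * E)) * ennreal E = ennreal (1 / m)"
    using assms(2,3) by (simp add: ennreal_mult[symmetric])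
  finally show ?thesis .
qed

section \<open>Piecewise smooth functions of time\<close>

text \<open>
  The values may lie in a space without a countable base, such as \<open>V'\<close>, so the usual rules for continuous
  functions into Euclidean spaces do not suffice.
\<close>
lemma continuous_on_borel_measurable_time:
  fixes f :: "real \<Rightarrow> 'a::topological_space"
  assumes "continuous_on {0..T} f"
  shows "f \<in> borel_measurable (time_measure T)"
proof -
  have "f \<in> borel_measurable (restrict_space borel {0<..T})"
    by (rule borel_measurable_continuous_on_restrict)
       (rule continuous_on_subset[OF assms], auto)
  moreover have "(\<lambda>t. t) \<in> time_measure T \<rightarrow>\<^sub>M restrict_space borel {0<..T}"
    by (rule measurable_restrict_space3) (auto intro: measurable_completion)
  ultimately show ?thesis by (rule measurable_compose[rotated])
qed

lemma bounded_measurable_time_integrable: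
  fixes f :: "real \<Rightarrow> 'a::{banach,second_countable_topology}"
  assumes "f \<in> borel_measurable (time_measure T)" "\<And>t. t \<in> {0<..T} \<Longrightarrow> norm (f t) \<le> B"
  shows "integrable (time_measure T) f"
proof (rule Bochner_Integration.integrable_bound[OF _ assms(1)])
  show "integrable (time_measure T) (\<lambda>t. B)"
    by (rule finite_measure.integrable_const) (intro finite_measure_lebesgue_on bounded_set_imp_lmeasurable, auto)
  show "AE t in time_measure T. norm (f t) \<le> norm B"
    by (rule AE_I2) (use assms(2) in \<open>force simp: space_restrict_space\<close>)
qed

lemma continuous_on_bounded_time:
  fixes f :: "real \<Rightarrow> 'a::real_normed_vector"
  assumes "continuous_on {0..T} f"
  obtains B where "\<And>t. t \<in> {0..T} \<Longrightarrow> norm (f t) \<le> B" "0 \<le> B"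
proof -
  have "bounded (f ` {0..T})"
    by (rule compact_imp_bounded) (rule compact_continuous_image[OF assms], simp)
  then obtain B where "\<forall>y\<in>f ` {0..T}. norm y \<le> B" unfolding bounded_iff by blast
  then have "\<And>t. t \<in> {0..T} \<Longrightarrow> norm (f t) \<le> \<bar>B\<bar>" by (meson abs_ge_self image_eqI order_trans)
  then show ?thesis using that abs_ge_zero by blast
qed

lemma continuous_on_integrable_time:
  fixes f :: "real \<Rightarrow> 'a::{banach,second_countable_topology}"
  assumes "continuous_on {0..T} f"
  shows "integrable (time_measure T) f"
proof -
  obtain B where "\<And>t. t \<in> {0..T} \<Longrightarrow> norm (f t) \<le> B"
    using continuous_on_bounded_time[OF assms] by blast
  then show ?thesis
    by (intro bounded_measurable_time_integrable[where B=B] continuous_on_borel_measurable_time assms) auto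
qed

lemma continuous_on_L2_space:
  fixes f :: "real \<Rightarrow> 'a::real_normed_vector"
  assumes "continuous_on {0..T} f"
  shows "f \<in> L2_space (time_measure T)"
  unfolding L2_space_def
  by (auto intro!: continuous_on_borel_measurable_time continuous_on_integrable_time
      continuous_intros assms)

lemma bounded_measurable_L2_space_time:
  fixes f :: "real \<Rightarrow> 'a::real_normed_vector"
  assumes "f \<in> borel_measurable (time_measure T)" "\<And>t. t \<in> {0<..T} \<Longrightarrow> norm (f t) \<le> B"
  shows "f \<in> L2_space (time_measure T)"
proof -
  have "integrable (time_measure T) (\<lambda>t. (norm (f t))\<^sup>2)"
    by (rule bounded_measurable_time_integrable[where B="B\<^sup>2"])
       (use assms in \<open>auto intro!: power_mono\<close>)
  then show ?thesis using assms(1) by (simp add: L2_space_def)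
qed

text \<open>
  Continuous on \<open>[0,T]\<close> and continuously differentiable with derivative \<open>D\<close> outside the finite set \<open>S\<close> of
  nodes. At the nodes \<open>D\<close> is arbitrary; measurability and boundedness make it integrable all the same.
\<close>
definition piecewise_deriv ::
  "real \<Rightarrow> real set \<Rightarrow> (real \<Rightarrow> 'a::real_normed_vector) \<Rightarrow> (real \<Rightarrow> 'a) \<Rightarrow> bool" where
  "piecewise_deriv T S w D \<longleftrightarrow> finite S \<and> continuous_on {0..T} w \<and>
     (\<forall>t\<in>{0<..<T} - S. (w has_vector_derivative D t) (at t) \<and> isCont D t) \<and>
     D \<in> borel_measurable (time_measure T) \<and> bounded (D ` {0<..T})"

lemma piecewise_deriv_bound:
  assumes "piecewise_deriv T S w D"
  obtains B where "\<And>t. t \<in> {0<..T} \<Longrightarrow> norm (D t) \<le> B" "0 \<le> B"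
proof -
  obtain B where "\<forall>y\<in>D ` {0<..T}. norm y \<le> B"
    using assms unfolding piecewise_deriv_def bounded_iff by blast
  then have "\<And>t. t \<in> {0<..T} \<Longrightarrow> norm (D t) \<le> \<bar>B\<bar>" by (meson abs_ge_self image_eqI order_trans)
  then show ?thesis using that abs_ge_zero by blast
qed

lemma piecewise_deriv_diff:
  fixes w w' :: "real \<Rightarrow> 'a::{real_normed_vector,second_countable_topology}"
  assumes "piecewise_deriv T S w D" "piecewise_deriv T S w' D'"
  shows "piecewise_deriv T S (\<lambda>t. w t - w' t) (\<lambda>t. D t - D' t)"
  using assms unfolding piecewise_deriv_def
  by (auto intro!: continuous_intros has_vector_derivative_diff bounded_minus_comp)

lemma piecewise_deriv_bounded_linear:
  assumes F: "bounded_linear F" and w: "piecewise_deriv T S w D"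
  shows "piecewise_deriv T S (\<lambda>t. F (w t)) (\<lambda>t. F (D t))"
proof -
  have "F \<in> borel_measurable borel"
    by (intro borel_measurable_continuous_onI linear_continuous_on F)
  moreover have "bounded (F ` D ` {0<..T})"
    by (rule bounded_linear_image[OF _ F]) (use w in \<open>simp add: piecewise_deriv_def\<close>)
  ultimately show ?thesis
    using w unfolding piecewise_deriv_def
    by (auto simp: image_image intro!: bounded_linear.continuous_on[OF F]
        bounded_linear.has_vector_derivative[OF F] bounded_linear.isCont[OF F]
        intro: measurable_compose)
qed

text \<open>
  The fundamental theorem of calculus for the Henstock-Kurzweil integral tolerates finitely many
  exceptional points; it is carried over to the Lebesgue integral on \<open>(0,T]\<close>.
\<close>
lemma integral_deriv_time:
  fixes f f' :: "real \<Rightarrow> real"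
  assumes T: "0 \<le> T" and S: "finite S" and f: "continuous_on {0..T} f"
    and d: "\<And>t. t \<in> {0<..<T} - S \<Longrightarrow> (f has_vector_derivative f' t) (at t)"
    and int: "integrable (time_measure T) f'"
  shows "(LINT t|time_measure T. f' t) = f T - f 0"
proof -
  have "(f' has_integral (f T - f 0)) {0..T}"
    by (rule fundamental_theorem_of_calculus_interior_strong[OF S T d f])
  then have "(f' has_integral (f T - f 0)) {0<..T}"
    by (subst (asm) has_integral_spike_set_eq[where T="{0<..T}"])
       (auto intro: negligible_subset[of "{0}"])
  moreover have "(f' has_integral (LINT t|time_measure T. f' t)) {0<..T}"
    by (rule has_integral_integral_lebesgue_on[OF int]) simp
  ultimately show ?thesis by (rule has_integral_unique[rotated])
qed

lemma integral_by_parts_time: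
  fixes f :: "real \<Rightarrow> real"
  assumes T: "0 \<le> T" and f: "piecewise_deriv T S f D" and \<phi>: "piecewise_deriv T S \<phi> \<psi>"
    and 0: "\<phi> 0 = 0" "\<phi> T = 0"
  shows "(LINT t|time_measure T. f t * \<psi> t) = - (LINT t|time_measure T. D t * \<phi> t)"
proof -
  have int: "integrable (time_measure T) (\<lambda>t. g t * k t)"
    if g: "continuous_on {0..T} g" and k: "piecewise_deriv T S h k" for g h k :: "real \<Rightarrow> real"
  proof -
    obtain B where B: "\<And>t. t \<in> {0..T} \<Longrightarrow> norm (g t) \<le> B" "0 \<le> B"
      using continuous_on_bounded_time[OF g] by blast
    obtain C where C: "\<And>t. t \<in> {0<..T} \<Longrightarrow> norm (k t) \<le> C" "0 \<le> C"
      using piecewise_deriv_bound[OF k] by blast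
    have [measurable]: "g \<in> borel_measurable (time_measure T)" "k \<in> borel_measurable (time_measure T)"
      using k continuous_on_borel_measurable_time[OF g] by (auto simp: piecewise_deriv_def)
    show ?thesis
      by (rule bounded_measurable_time_integrable[where B="B * C"])
         (use B C in \<open>auto simp: abs_mult intro!: mult_mono\<close>)
  qed
  have i1: "integrable (time_measure T) (\<lambda>t. f t * \<psi> t)"
    using int[OF _ \<phi>] f by (auto simp: piecewise_deriv_def)
  have i2: "integrable (time_measure T) (\<lambda>t. D t * \<phi> t)"
    using int[OF _ f, of \<phi>] \<phi> by (auto simp: piecewise_deriv_def mult.commute)
  have "(LINT t|time_measure T. f t * \<psi> t + D t * \<phi> t) = f T * \<phi> T - f 0 * \<phi> 0"
  proof (rule integral_deriv_time[OF T])
    show "finite S" using f by (simp add: piecewise_deriv_def)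
    show "continuous_on {0..T} (\<lambda>t. f t * \<phi> t)"
      using f \<phi> by (auto simp: piecewise_deriv_def intro!: continuous_intros)
    show "((\<lambda>t. f t * \<phi> t) has_vector_derivative f t * \<psi> t + D t * \<phi> t) (at t)"
      if "t \<in> {0<..<T} - S" for t
      using f \<phi> that by (auto simp: piecewise_deriv_def intro!: has_vector_derivative_mult)
  qed (use i1 i2 in auto)
  then show ?thesis using i1 i2 0 by simp
qed

lemma test_function_piecewise_deriv:
  fixes \<phi> :: "real \<Rightarrow> real"
  assumes T: "0 < T" and \<phi>: "\<phi> \<in> test_functions {0<..<T}"
  shows "piecewise_deriv T {} \<phi> (deriv \<phi>)" "\<phi> 0 = 0" "\<phi> T = 0"
proof -
  have der: "(\<phi> has_real_derivative deriv \<phi> t) (at t)" for t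
    using \<phi> by (auto simp: test_functions_def field_differentiable_derivI
        DERIV_deriv_iff_real_differentiable)
  have "frechet_derivative \<phi> (at t) = (\<lambda>h. h * deriv \<phi> t)" for t
    using frechet_derivative_at[OF der[of t, unfolded has_field_derivative_def]]
    by (simp add: mult.commute fun_eq_iff)
  with \<phi> have cont: "continuous_on UNIV (deriv \<phi>)"
    by (simp add: test_functions_def)
  have "continuous_on {0..T} \<phi>"
    by (intro continuous_at_imp_continuous_on ballI DERIV_isCont[OF der])
  moreover have "continuous_on {0..T} (deriv \<phi>)"
    using cont continuous_on_subset by blast
  moreover have "bounded (deriv \<phi> ` {0<..T})"
    by (rule bounded_subset[of "deriv \<phi> ` {0..T}"])
       (intro compact_imp_bounded compact_continuous_image \<open>continuous_on {0..T} (deriv \<phi>)\<close>, auto)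
  ultimately show "piecewise_deriv T {} \<phi> (deriv \<phi>)"
    using der cont unfolding piecewise_deriv_def
    by (auto intro!: continuous_on_borel_measurable_time
        simp: has_real_derivative_iff_has_vector_derivative[symmetric] continuous_on_eq_continuous_at)
  show "\<phi> 0 = 0" "\<phi> T = 0"
    using \<phi> T by (auto simp: test_functions_def subset_eq)
qed

text \<open>
  A continuously differentiable transition from \<open>0\<close> on the negative axis to the limit \<open>1\<close> at infinity.
  Squaring the positive part is what makes it differentiable at the origin.
\<close>
definition cutoff :: "real \<Rightarrow> real" where
  "cutoff x = (max 0 x)\<^sup>2 / (1 + (max 0 x)\<^sup>2)"

lemma has_real_derivative_max_power2:
  "((\<lambda>x. (max 0 x)\<^sup>2) has_real_derivative 2 * max 0 x) (at (x::real))"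
proof -
  consider "x < 0" | "x = 0" | "0 < x" by linarith
  then show ?thesis
  proof cases
    case 1
    have "((\<lambda>x. 0) has_real_derivative 2 * max 0 x) (at x)" using 1 by simp
    then show ?thesis
      by (rule has_field_derivative_transform_within_open[of _ _ _ "{..<0}"]) (use 1 in auto)
  next
    case 2
    have "((\<lambda>h. max 0 h) \<longlongrightarrow> max 0 0) (at (0::real))" by (intro tendsto_intros)
    then have "((\<lambda>h. (max 0 h)\<^sup>2 / h) \<longlongrightarrow> max 0 0) (at (0::real))"
      by (elim Lim_transform_eventually[OF _ eventually_mono[OF eventually_neq_at_within]])
         (auto simp: power2_eq_square max_def)
    then show ?thesis using 2 by (simp add: DERIV_def)
  next
    case 3
    have "((\<lambda>x. x\<^sup>2) has_real_derivative 2 * max 0 x) (at x)"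
      using 3 by (auto intro!: derivative_eq_intros)
    then show ?thesis
      by (rule has_field_derivative_transform_within_open[of _ _ _ "{0<..}"]) (use 3 in auto)
  qed
qed

lemma cutoff_denominator_pos: "0 < 1 + (max 0 (x::real))\<^sup>2"
  by (simp add: add_pos_nonneg)

lemma cutoff_bounds: "0 \<le> cutoff x" "cutoff x \<le> 1"
  using cutoff_denominator_pos[of x] by (auto simp: cutoff_def field_simps)

lemma cutoff_nonpos: "x \<le> 0 \<Longrightarrow> cutoff x = 0"
  by (simp add: cutoff_def)

lemma cutoff_deriv:
  "(cutoff has_real_derivative 2 * max 0 x / (1 + (max 0 x)\<^sup>2)\<^sup>2) (at x)"
  unfolding cutoff_def
  by (rule derivative_eq_intros has_real_derivative_max_power2 refl)+
     (use cutoff_denominator_pos[of x] in \<open>auto simp: field_simps power2_eq_square\<close>)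

lemma cutoff_tendsto_1:
  assumes "0 < c"
  shows "(\<lambda>n. cutoff (real n * c - 1)) \<longlonglongrightarrow> 1"
proof -
  have "filterlim (\<lambda>n. real n * c - 1) at_top sequentially"
    using assms by real_asymp
  moreover have "(cutoff \<longlongrightarrow> 1) at_top"
  proof (rule Lim_transform_eventually)
    show "((\<lambda>x. x\<^sup>2 / (1 + x\<^sup>2)) \<longlongrightarrow> (1::real)) at_top"
      by real_asymp
    show "\<forall>\<^sub>F x in at_top. x\<^sup>2 / (1 + x\<^sup>2) = cutoff x"
      using eventually_ge_at_top[of 0] by eventually_elim (simp add: cutoff_def)
  qed
  ultimately show ?thesis by (rule filterlim_compose[rotated])
qed

text \<open>
  A variant of the fundamental lemma of the calculus of variations. The function \<open>s\<close> need not
  be differentiable at the nodes or vanish at the end points, so it is multiplied by a cutoff that vanishes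
  near these finitely many points. The products are test functions, they are dominated by \<open>s\<close>, and they
  converge to \<open>s\<close> off a finite set.
\<close>
lemma test_functions_determine_integral:
  fixes h s :: "real \<Rightarrow> real"
  assumes T: "0 < T" and h: "integrable (time_measure T) h"
    and 0: "\<And>\<phi>. \<phi> \<in> test_functions {0<..<T} \<Longrightarrow> (LINT t|time_measure T. h t * \<phi> t) = 0"
    and s: "piecewise_deriv T S s D"
  shows "(LINT t|time_measure T. h t * s t) = 0"
proof -
  have S: "finite S" and cs: "continuous_on {0..T} s"
    and ds: "\<And>t. t \<in> {0<..<T} - S \<Longrightarrow> (s has_real_derivative D t) (at t)"
    and cD: "\<And>t. t \<in> {0<..<T} - S \<Longrightarrow> isCont D t"
    using s by (auto simp: piecewise_deriv_def has_real_derivative_iff_has_vector_derivative)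
  \<comment> \<open>A polynomial that is positive exactly on \<open>(0,T)\<close> without the nodes; its superlevel sets
      \<open>n p(t) \<ge> 1\<close> are compact and exhaust this set.\<close>
  define p where "p = [:0, 1:] * [:T, -1:] * (\<Prod>\<sigma>\<in>S. [:-\<sigma>, 1:]\<^sup>2)"
  have pt: "poly p t = t * (T - t) * (\<Prod>\<sigma>\<in>S. (t - \<sigma>)\<^sup>2)" for t
    by (simp add: p_def poly_prod algebra_simps)
  have pos_iff: "0 < poly p t \<longleftrightarrow> t \<in> {0<..<T} - S" for t
  proof -
    have q: "0 \<le> (\<Prod>\<sigma>\<in>S. (t - \<sigma>)\<^sup>2)" by (simp add: prod_nonneg)
    have z: "(\<Prod>\<sigma>\<in>S. (t - \<sigma>)\<^sup>2) = 0 \<longleftrightarrow> t \<in> S" using S by auto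
    have "0 < poly p t \<longleftrightarrow> 0 < t * (T - t) \<and> (\<Prod>\<sigma>\<in>S. (t - \<sigma>)\<^sup>2) \<noteq> 0"
      unfolding pt using q by (auto simp: zero_less_mult_iff)
    also have "0 < t * (T - t) \<longleftrightarrow> t \<in> {0<..<T}" using T by (auto simp: zero_less_mult_iff)
    finally show ?thesis using z by auto
  qed
  define \<phi> where "\<phi> n t = s t * cutoff (real n * poly p t - 1)" for n t
  define \<psi> where "\<psi> n t = (if 0 < poly p t then D t * cutoff (real n * poly p t - 1) +
    s t * (2 * max 0 (real n * poly p t - 1) / (1 + (max 0 (real n * poly p t - 1))\<^sup>2)\<^sup>2 *
      (real n * poly (pderiv p) t)) else 0)" for n t
  have op: "open {t. 0 < poly p t}" by (intro open_Collect_less continuous_intros)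
  have on: "open {t. real n * poly p t < 1}" for n by (intro open_Collect_less continuous_intros)
  \<comment> \<open>The open sets \<open>p > 0\<close> and \<open>n p < 1\<close> cover the line: on the first the product rule applies, on
      the second \<open>\<phi> n\<close> is identically zero.\<close>
  have cover: "0 < poly p t \<or> real n * poly p t < 1" for n t
    by (cases "0 < poly p t") (auto intro: le_less_trans[of _ 0] simp: mult_nonneg_nonpos)
  have \<phi>_0: "\<phi> n t = 0" if "real n * poly p t \<le> 1" for n t
    using that by (simp add: \<phi>_def cutoff_nonpos)
  have \<psi>_0: "\<psi> n t = 0" if "real n * poly p t < 1" for n t
    using that by (simp add: \<psi>_def cutoff_nonpos)
  have der: "(\<phi> n has_real_derivative \<psi> n t) (at t)" for n t
  proof (cases "0 < poly p t")
    case True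
    then have t: "t \<in> {0<..<T} - S" by (simp add: pos_iff)
    have "((\<lambda>t. cutoff (real n * poly p t - 1)) has_real_derivative
      2 * max 0 (real n * poly p t - 1) / (1 + (max 0 (real n * poly p t - 1))\<^sup>2)\<^sup>2 *
      (real n * poly (pderiv p) t)) (at t)"
      by (rule DERIV_chain2[OF cutoff_deriv]) (auto intro!: derivative_eq_intros poly_DERIV)
    from DERIV_mult[OF ds[OF t] this] show ?thesis
      unfolding \<phi>_def using True by (simp add: \<psi>_def algebra_simps)
  next
    case False
    then have "real n * poly p t < 1" using cover by blast
    moreover from this have "\<psi> n t = 0" by (rule \<psi>_0)
    then have "((\<lambda>t. 0) has_real_derivative \<psi> n t) (at t)" by simp
    ultimately show ?thesis
      by (elim has_field_derivative_transform_within_open[OF _ on[of n]]) (auto simp: \<phi>_0)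
  qed
  have cont\<psi>: "isCont (\<psi> n) t" for n t
  proof (cases "0 < poly p t")
    case True
    have "continuous_on {t. 0 < poly p t} (\<psi> n)"
    proof (subst continuous_on_cong[OF refl])
      show "\<psi> n t = D t * cutoff (real n * poly p t - 1) +
        s t * (2 * max 0 (real n * poly p t - 1) / (1 + (max 0 (real n * poly p t - 1))\<^sup>2)\<^sup>2 *
        (real n * poly (pderiv p) t))" if "t \<in> {t. 0 < poly p t}" for t
        using that by (simp add: \<psi>_def)
      have "continuous_on {t. 0 < poly p t} D"
        using cD by (auto intro!: continuous_at_imp_continuous_on simp: pos_iff)
      moreover have "continuous_on {t. 0 < poly p t} s"
        by (rule continuous_on_subset[OF cs]) (auto simp: pos_iff)
      moreover have "continuous_on X (\<lambda>t. cutoff (real n * poly p t - 1))" for X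
      proof (rule continuous_on_compose2[of UNIV cutoff])
        show "continuous_on UNIV cutoff"
          using cutoff_deriv DERIV_isCont by (blast intro: continuous_at_imp_continuous_on)
      qed (auto intro!: continuous_intros)
      moreover have "1 + (max 0 y)\<^sup>2 \<noteq> 0" for y :: real using cutoff_denominator_pos[of y] by linarith
      ultimately show "continuous_on {t. 0 < poly p t} (\<lambda>t. D t * cutoff (real n * poly p t - 1) +
        s t * (2 * max 0 (real n * poly p t - 1) / (1 + (max 0 (real n * poly p t - 1))\<^sup>2)\<^sup>2 *
        (real n * poly (pderiv p) t)))"
        by (auto intro!: continuous_intros)
    qed
    then show ?thesis using True op by (simp add: continuous_on_eq_continuous_at)
  next
    case False
    then have "real n * poly p t < 1" using cover by blast
    moreover have "continuous_on {t. real n * poly p t < 1} (\<psi> n)"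
      by (subst continuous_on_cong[OF refl \<psi>_0]) auto
    ultimately show ?thesis using on by (simp add: continuous_on_eq_continuous_at)
  qed
  have test: "\<phi> n \<in> test_functions {0<..<T}" for n
  proof -
    have f: "frechet_derivative (\<phi> n) (at t) = (\<lambda>h. h * \<psi> n t)" for t
      using frechet_derivative_at[OF der[of n t, unfolded has_field_derivative_def]]
      by (simp add: mult.commute fun_eq_iff)
    have "compact ({0..T} \<inter> {t. 1 \<le> real n * poly p t})"
      by (intro compact_Int_closed closed_Collect_le continuous_intros) simp
    moreover have "{0..T} \<inter> {t. 1 \<le> real n * poly p t} \<subseteq> {0<..<T}"
      using cover pos_iff by (fastforce simp: not_less[symmetric])
    moreover have "\<phi> n t = 0" if "t \<notin> {0..T} \<inter> {t. 1 \<le> real n * poly p t}" for t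
      using that cover[of t n] pos_iff[of t] by (intro \<phi>_0) auto
    ultimately have "\<exists>C. compact C \<and> C \<subseteq> {0<..<T} \<and> (\<forall>t. t \<notin> C \<longrightarrow> \<phi> n t = 0)" by blast
    moreover have "\<phi> n differentiable (at t)" for t
      using der by (auto simp: real_differentiable_def)
    moreover have "continuous_on UNIV (\<psi> n)"
      using cont\<psi> by (simp add: continuous_at_imp_continuous_on)
    ultimately show ?thesis by (simp add: test_functions_def f)
  qed
  obtain B where B: "\<And>t. t \<in> {0..T} \<Longrightarrow> norm (s t) \<le> B" "0 \<le> B"
    using continuous_on_bounded_time[OF cs] by blast
  have [measurable]: "h \<in> borel_measurable (time_measure T)" using h by simp
  have [measurable]: "s \<in> borel_measurable (time_measure T)"
    by (rule continuous_on_borel_measurable_time[OF cs])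
  have [measurable]: "\<phi> n \<in> borel_measurable (time_measure T)" for n
    by (rule continuous_on_borel_measurable_time)
       (meson der DERIV_isCont continuous_at_imp_continuous_on)
  have "(\<lambda>n. LINT t|time_measure T. h t * \<phi> n t) \<longlonglongrightarrow> (LINT t|time_measure T. h t * s t)"
  proof (rule integral_dominated_convergence[where w="\<lambda>t. norm (h t) * B"])
    have "negligible (insert T S)" using S by (simp add: negligible_finite)
    then have "AE t in lebesgue. t \<notin> insert T S"
      by (intro AE_not_in) (simp only: negligible_iff_null_sets)
    then have "AE t in time_measure T. t \<notin> insert T S"
      by (subst AE_restrict_space_iff) (auto elim: eventually_mono)
    then show "AE t in time_measure T. (\<lambda>n. h t * \<phi> n t) \<longlonglongrightarrow> h t * s t"
    proof (rule AE_mp, intro AE_I2 impI)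
      fix t assume "t \<in> space (time_measure T)" "t \<notin> insert T S"
      then have "0 < poly p t" by (auto simp: pos_iff space_restrict_space)
      from tendsto_mult[OF tendsto_const[of "h t"] tendsto_mult[OF tendsto_const[of "s t"] cutoff_tendsto_1[OF this]]]
      show "(\<lambda>n. h t * \<phi> n t) \<longlonglongrightarrow> h t * s t" by (simp add: \<phi>_def)
    qed
    show "AE t in time_measure T. norm (h t * \<phi> n t) \<le> norm (h t) * B" for n
    proof (rule AE_I2)
      fix t assume "t \<in> space (time_measure T)"
      then have "norm (s t) \<le> B" using B by (auto simp: space_restrict_space)
      moreover have "\<bar>cutoff (real n * poly p t - 1)\<bar> \<le> 1" using cutoff_bounds by (simp add: abs_le_iff)
      ultimately have "norm (\<phi> n t) \<le> B * 1"
        unfolding \<phi>_def norm_mult by (intro mult_mono) auto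
      then show "norm (h t * \<phi> n t) \<le> norm (h t) * B"
        by (simp add: abs_mult mult_left_mono)
    qed
  qed (use h in auto)
  then show ?thesis using 0[OF test] by (simp add: LIMSEQ_const_iff)
qed

section \<open>The embedding of \<open>V\<close> in \<open>H\<close> and initial values\<close>

locale H1_embedding =
  fixes \<Omega> :: "(real^'d) set"
    and val :: "'v::{real_inner,banach,second_countable_topology} \<Rightarrow> real^'d \<Rightarrow> real"
    and grad :: "'v \<Rightarrow> real^'d \<Rightarrow> real^'d"
  assumes H1: "H1_subspace \<Omega> val grad"
begin

abbreviation space_measure :: "(real^'d) measure" where "space_measure \<equiv> lebesgue_on \<Omega>"

lemmas H1_parts = H1[unfolded H1_subspace_def]

lemma val_L2: "val v \<in> L2_space space_measure"
  and grad_L2: "grad v \<in> L2_space space_measure"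
  using H1_parts[THEN conjunct1] by auto

lemma grad_norm_le: "L2_norm space_measure (grad v) \<le> norm v"
  using H1_parts[THEN conjunct2, THEN conjunct2, THEN conjunct2, THEN conjunct2, THEN conjunct1] by (rule spec)

lemma val_measurable [measurable]: "val v \<in> borel_measurable space_measure"
  and grad_measurable [measurable]: "grad v \<in> borel_measurable space_measure"
  using L2_spaceD(1)[OF val_L2] L2_spaceD(1)[OF grad_L2] by auto

lemma AE_val_lin: "AE x in space_measure. val (a *\<^sub>R v + b *\<^sub>R w) x = a * val v x + b * val w x"
  and AE_grad_lin: "AE x in space_measure. grad (a *\<^sub>R v + b *\<^sub>R w) x = a *\<^sub>R grad v x + b *\<^sub>R grad w x"
proof -
  have "AE x in space_measure. val (a *\<^sub>R v + b *\<^sub>R w) x = a * val v x + b * val w x \<and>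
          grad (a *\<^sub>R v + b *\<^sub>R w) x = a *\<^sub>R grad v x + b *\<^sub>R grad w x"
    using H1_parts[THEN conjunct2, THEN conjunct1] by (elim allE)
  then show "AE x in space_measure. val (a *\<^sub>R v + b *\<^sub>R w) x = a * val v x + b * val w x"
    "AE x in space_measure. grad (a *\<^sub>R v + b *\<^sub>R w) x = a *\<^sub>R grad v x + b *\<^sub>R grad w x"
    by auto
qed

lemma AE_val_0: "AE x in space_measure. val 0 x = 0"
  using AE_val_lin[of 0 0 0 0] by simp

lemma AE_grad_0: "AE x in space_measure. grad 0 x = 0"
  using AE_grad_lin[of 0 0 0 0] by simp

lemma AE_val_diff: "AE x in space_measure. val (v - w) x = val v x - val w x"
  using AE_val_lin[of 1 v "-1" w] by simp

lemma AE_grad_diff: "AE x in space_measure. grad (v - w) x = grad v x - grad w x"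
  using AE_grad_lin[of 1 v "-1" w] by simp

lemma val_eq_0D: "AE x in space_measure. val v x = 0 \<Longrightarrow> v = 0"
  using H1_parts[THEN conjunct2, THEN conjunct2, THEN conjunct1] by simp

lemma val_norm_bound: obtains C where "\<And>v. L2_norm space_measure (val v) \<le> C * norm v" "0 \<le> C"
proof -
  obtain C where "\<And>v. L2_norm space_measure (val v) \<le> C * norm v"
    using H1_parts[THEN conjunct2, THEN conjunct2, THEN conjunct2, THEN conjunct1] by auto
  then have "L2_norm space_measure (val v) \<le> \<bar>C\<bar> * norm v" for v
    by (meson abs_ge_self mult_right_mono norm_ge_zero order_trans)
  then show ?thesis using that abs_ge_zero by blast
qed

text \<open>
  Serves both the \<open>H\<close> inner product (\<open>F = val\<close>, weight one) and the forms of the empirical interpolation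
  (\<open>F = grad\<close>, weight \<open>q\<^sub>m\<close>). The representation of elements of \<open>V\<close> by functions is linear only up to null
  sets, but integrals do not see these.
\<close>
lemma bounded_bilinear_weighted:
  fixes F :: "'v \<Rightarrow> real^'d \<Rightarrow> 'e::{real_inner,second_countable_topology}"
  assumes L2: "\<And>v. F v \<in> L2_space space_measure"
    and lin: "\<And>v w a b. AE x in space_measure. F (a *\<^sub>R v + b *\<^sub>R w) x = a *\<^sub>R F v x + b *\<^sub>R F w x"
    and bound: "\<And>v. L2_norm space_measure (F v) \<le> C * norm v"
    and \<kappa>: "\<kappa> \<in> borel_measurable space_measure" "\<And>x. x \<in> \<Omega> \<Longrightarrow> \<bar>\<kappa> x\<bar> \<le> c" "0 \<le> c"
  shows "bounded_bilinear (\<lambda>v w. LINT x|space_measure. \<kappa> x * (F v x \<bullet> F w x))"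
    (is "bounded_bilinear ?b")
proof -
  have meas [measurable]: "F v \<in> borel_measurable space_measure" for v
    using L2_spaceD(1)[OF L2] .
  note \<kappa>(1) [measurable]
  have pw: "\<bar>\<kappa> x * (F v x \<bullet> F w x)\<bar> \<le> c * (norm (F v x) * norm (F w x))"
    if "x \<in> space space_measure" for v w x
    using \<kappa>(2)[of x] \<kappa>(3) that unfolding abs_mult
    by (intro mult_mono Cauchy_Schwarz_ineq2) (auto simp: space_restrict_space)
  have int: "integrable space_measure (\<lambda>x. \<kappa> x * (F v x \<bullet> F w x))" for v w
    by (rule L2_dominated_product(1)[OF L2 L2 _ \<kappa>(3) pw]) measurable
  have le: "\<bar>?b v w\<bar> \<le> c * (L2_norm space_measure (F v) * L2_norm space_measure (F w))" for v w
    by (rule L2_dominated_product(2)[OF L2 L2 _ \<kappa>(3) pw]) measurable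
  have sym: "?b v w = ?b w v" for v w by (simp add: inner_commute)
  have linear: "?b (a *\<^sub>R v + b *\<^sub>R v') w = a * ?b v w + b * ?b v' w" for a b v v' w
  proof -
    have "?b (a *\<^sub>R v + b *\<^sub>R v') w =
      (LINT x|space_measure. a * (\<kappa> x * (F v x \<bullet> F w x)) + b * (\<kappa> x * (F v' x \<bullet> F w x)))"
    proof (rule integral_cong_AE)
      show "AE x in space_measure. \<kappa> x * (F (a *\<^sub>R v + b *\<^sub>R v') x \<bullet> F w x) =
          a * (\<kappa> x * (F v x \<bullet> F w x)) + b * (\<kappa> x * (F v' x \<bullet> F w x))"
        using lin[of a v b v'] by eventually_elim (simp add: inner_add_left algebra_simps)
    qed measurable
    also have "\<dots> = a * ?b v w + b * ?b v' w" using int by simp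
    finally show ?thesis .
  qed
  have add: "?b (v + v') w = ?b v w + ?b v' w" for v v' w using linear[of 1 v 1 v' w] by simp
  have scale: "?b (r *\<^sub>R v) w = r *\<^sub>R ?b v w" for r v w using linear[of r v 0 0 w] by simp
  show ?thesis
  proof
    show "?b (v + v') w = ?b v w + ?b v' w" for v v' w by (rule add)
    show "?b v (w + w') = ?b v w + ?b v w'" for v w w'
      using add[of w w' v] by (simp only: sym[of v])
    show "?b (r *\<^sub>R v) w = r *\<^sub>R ?b v w" for r v w by (rule scale)
    show "?b v (r *\<^sub>R w) = r *\<^sub>R ?b v w" for r v w
      using scale[of r w v] by (simp only: sym[of v])
    have "norm (?b v w) \<le> norm v * norm w * (c * (C * C))" for v w
    proof -
      have "norm (?b v w) \<le> c * (L2_norm space_measure (F v) * L2_norm space_measure (F w))"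
        using le by simp
      also have "\<dots> \<le> c * ((C * norm v) * (C * norm w))"
        using bound \<kappa>(3) order_trans[OF L2_norm_nonneg bound]
        by (intro mult_left_mono mult_mono L2_norm_nonneg)
      finally show ?thesis by (simp add: mult_ac)
    qed
    then show "\<exists>K. \<forall>v w. norm (?b v w) \<le> norm v * norm w * K" by blast
  qed
qed

definition H_inner :: "'v \<Rightarrow> 'v \<Rightarrow> real" where
  "H_inner v w = L2_inner space_measure (val v) (val w)"

sublocale H: bounded_bilinear H_inner
proof -
  obtain C where C: "\<And>v. L2_norm space_measure (val v) \<le> C * norm v" "0 \<le> C" using val_norm_bound by blast
  from bounded_bilinear_weighted[OF val_L2 AE_val_lin[folded real_scaleR_def] C(1), of "\<lambda>_. 1" 1]
  show "bounded_bilinear H_inner" by (simp add: H_inner_def[abs_def] L2_inner_def)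
qed

lemma H_inner_commute: "H_inner v w = H_inner w v"
  by (simp add: H_inner_def L2_inner_def mult.commute)

lemma H_inner_nonneg: "0 \<le> H_inner v v"
  by (simp add: H_inner_def L2_inner_def)

text \<open>The embedding into \<open>H\<close> is injective.\<close>
lemma H_inner_eq_0D: "H_inner v v = 0 \<Longrightarrow> v = 0"
proof (rule val_eq_0D, rule L2_norm_eq_0_AE[OF val_L2])
  assume "H_inner v v = 0"
  then show "L2_norm space_measure (val v) = 0"
    by (simp add: H_inner_def L2_inner_def L2_norm_def power2_eq_square)
qed

text \<open>
  Definiteness of the \<open>H\<close> inner product makes the projection unique, so the description by
  orthogonality does pick out \<open>v\<close>.
\<close>
lemma H_proj_val_self:
  assumes W: "subspace W" and v: "v \<in> W"
  shows "H_proj \<Omega> val W (val v) = v"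
proof -
  have eq: "L2_inner space_measure (\<lambda>x. val v x - val p x) (val w) = H_inner (v - p) w" for p w
  proof -
    have "(LINT x|space_measure. (val v x - val p x) * val w x) =
        (LINT x|space_measure. val (v - p) x * val w x)"
      by (rule integral_cong_AE) (use AE_val_diff[of v p] in \<open>auto elim: eventually_mono\<close>)
    then show ?thesis by (simp add: H_inner_def L2_inner_def)
  qed
  show ?thesis unfolding H_proj_def eq
  proof (rule the_equality)
    show "v \<in> W \<and> (\<forall>w\<in>W. H_inner (v - v) w = 0)" using v by (simp add: H.zero_left)
    fix p assume p: "p \<in> W \<and> (\<forall>w\<in>W. H_inner (v - p) w = 0)"
    with v W have "H_inner (v - p) (v - p) = 0" by (simp add: subspace_diff)
    then show "p = v" using H_inner_eq_0D by fastforce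
  qed
qed

text \<open>
  A continuous function with values in \<open>V\<close> is a continuous representative with values in \<open>H\<close>. Any other
  representative agrees with it at almost every time, in particular at times arbitrarily close to
  \<open>0\<close>, and by continuity of both at \<open>0\<close>.
\<close>
lemma initial_value_AE:
  assumes T: "0 < T" and w: "continuous_on {0..T} w"
  shows "initial_value \<Omega> T val w \<in> L2_space space_measure"
    "AE x in space_measure. initial_value \<Omega> T val w x = val (w 0) x"
proof -
  define P where "P W \<longleftrightarrow>
     (\<forall>t\<in>{0..T}. W t \<in> L2_space space_measure) \<and>
     (\<forall>t\<in>{0..T}. ((\<lambda>s. L2_norm space_measure (\<lambda>x. W s x - W t x)) \<longlongrightarrow> 0)
        (at t within {0..T})) \<and>
     (AE t in time_measure T. AE x in space_measure. W t x = val (w t) x)"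
    for W :: "real \<Rightarrow> real^'d \<Rightarrow> real"
  have cont: "((\<lambda>s. L2_norm space_measure (\<lambda>x. val (w s) x - val (w t) x)) \<longlongrightarrow> 0) (at t within {0..T})"
    if "t \<in> {0..T}" for t
  proof -
    obtain C where C: "\<And>v. L2_norm space_measure (val v) \<le> C * norm v" "0 \<le> C" using val_norm_bound by blast
    have "L2_norm space_measure (\<lambda>x. val (w s) x - val (w t) x) = L2_norm space_measure (val (w s - w t))" for s
      by (rule L2_norm_cong_AE) (use AE_val_diff[of "w s" "w t"] in \<open>auto elim: eventually_mono\<close>)
    then have le: "norm (L2_norm space_measure (\<lambda>x. val (w s) x - val (w t) x)) \<le> C * norm (w s - w t)" for s
      using C(1)[of "w s - w t"] L2_norm_nonneg[of space_measure "val (w s - w t)"] by simp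
    have "((\<lambda>s. w s) \<longlongrightarrow> w t) (at t within {0..T})" using w that by (simp add: continuous_on_def)
    then have "((\<lambda>s. C * norm (w s - w t)) \<longlongrightarrow> C * norm (w t - w t)) (at t within {0..T})"
      by (intro tendsto_intros)
    then have lim: "((\<lambda>s. C * norm (w s - w t)) \<longlongrightarrow> 0) (at t within {0..T})" by simp
    show ?thesis by (rule Lim_null_comparison[OF always_eventually lim]) (use le in blast)
  qed
  have "P (\<lambda>t. val (w t))"
    unfolding P_def by (intro conjI ballI val_L2 cont) simp_all
  then have "\<exists>h W. P W \<and> h = W 0" by (intro exI[of _ "val (w 0)"] exI[of _ "\<lambda>t. val (w t)"]) simp
  then have "\<exists>W. P W \<and> (SOME h. \<exists>W. P W \<and> h = W 0) = W 0" by (rule someI_ex)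
  moreover have "initial_value \<Omega> T val w = (SOME h. \<exists>W. P W \<and> h = W 0)"
    unfolding initial_value_def P_def conj_assoc ..
  ultimately have "\<exists>W. P W \<and> initial_value \<Omega> T val w = W 0" by (simp only:)
  then obtain W where W: "P W" and iv: "initial_value \<Omega> T val w = W 0" by blast
  have WL2: "\<And>t. t \<in> {0..T} \<Longrightarrow> W t \<in> L2_space space_measure" using W by (simp add: P_def)
  then have Wm: "\<And>t. t \<in> {0..T} \<Longrightarrow> W t \<in> borel_measurable space_measure" using L2_spaceD(1) by blast
  show 1: "initial_value \<Omega> T val w \<in> L2_space space_measure" using WL2[of 0] T by (simp add: iv)
  have [measurable]: "W 0 \<in> borel_measurable space_measure" using Wm[of 0] T by simp
  define d where "d = (\<lambda>x. W 0 x - val (w 0) x)"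
  have [measurable]: "d \<in> borel_measurable space_measure" by (simp add: d_def)
  \<comment> \<open>A cheap substitute for the triangle inequality of the \<open>L\<^sup>2\<close> norm.\<close>
  have split: "(a - b)\<^sup>2 \<le> 2 * (s - a)\<^sup>2 + 2 * (s - b)\<^sup>2" for a b s :: real
  proof -
    have "0 \<le> ((s - a) + (s - b))\<^sup>2" by simp
    then show ?thesis by (simp add: power2_eq_square algebra_simps)
  qed
  have diffL2: "(\<lambda>x. f x - g x) \<in> L2_space space_measure"
    if "f \<in> L2_space space_measure" "g \<in> L2_space space_measure" for f g :: "real^'d \<Rightarrow> real"
  proof -
    have "integrable space_measure (\<lambda>x. (f x - g x)\<^sup>2)"
    proof (rule Bochner_Integration.integrable_bound)
      show "integrable space_measure (\<lambda>x. 2 * (norm (f x))\<^sup>2 + 2 * (norm (g x))\<^sup>2)"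
        using L2_spaceD(2)[OF that(1)] L2_spaceD(2)[OF that(2)] by simp
      show "AE x in space_measure. norm ((f x - g x)\<^sup>2) \<le> norm (2 * (norm (f x))\<^sup>2 + 2 * (norm (g x))\<^sup>2)"
        by (rule AE_I2) (use split[of _ _ 0] in simp)
    qed (use L2_spaceD(1)[OF that(1)] L2_spaceD(1)[OF that(2)] in measurable)
    then show ?thesis using L2_spaceD(1)[OF that(1)] L2_spaceD(1)[OF that(2)] by (simp add: L2_space_def)
  qed
  have T0: "0 \<in> {0..T}" using T by simp
  have d2: "d \<in> L2_space space_measure" unfolding d_def by (rule diffL2) (use WL2 T0 val_L2 in auto)
  have le: "(L2_norm space_measure d)\<^sup>2 \<le> 2 * (L2_norm space_measure (\<lambda>x. W t x - W 0 x))\<^sup>2 +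
       2 * (L2_norm space_measure (\<lambda>x. val (w t) x - val (w 0) x))\<^sup>2"
    if t: "t \<in> {0..T}" and eq: "AE x in space_measure. W t x = val (w t) x" for t
  proof -
    have i: "integrable space_measure (\<lambda>x. (W t x - W 0 x)\<^sup>2)"
      "integrable space_measure (\<lambda>x. (val (w t) x - val (w 0) x)\<^sup>2)"
      using L2_spaceD(2)[OF diffL2[OF WL2[OF t] WL2[OF T0]]] L2_spaceD(2)[OF diffL2[OF val_L2 val_L2]]
      by simp_all
    have "(LINT x|space_measure. (norm (d x))\<^sup>2) \<le>
      (LINT x|space_measure. 2 * (W t x - W 0 x)\<^sup>2 + 2 * (val (w t) x - val (w 0) x)\<^sup>2)"
    proof (rule integral_mono_AE[OF L2_spaceD(2)[OF d2]])
      show "AE x in space_measure. (norm (d x))\<^sup>2 \<le> 2 * (W t x - W 0 x)\<^sup>2 + 2 * (val (w t) x - val (w 0) x)\<^sup>2"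
        using eq by eventually_elim (use split in \<open>simp add: d_def\<close>)
    qed (use i in auto)
    then show ?thesis using i by (simp add: L2_norm_power2)
  qed
  have "(L2_norm space_measure d)\<^sup>2 \<le> 0"
  proof (rule field_le_epsilon)
    fix e :: real assume e: "0 < e"
    have "((\<lambda>t. 2 * (L2_norm space_measure (\<lambda>x. W t x - W 0 x))\<^sup>2 +
       2 * (L2_norm space_measure (\<lambda>x. val (w t) x - val (w 0) x))\<^sup>2) \<longlongrightarrow> 2 * 0\<^sup>2 + 2 * 0\<^sup>2) (at 0 within {0..T})"
      using W T0 cont[OF T0] unfolding P_def by (intro tendsto_intros) auto
    then have "\<forall>\<^sub>F t in at 0 within {0..T}. 2 * (L2_norm space_measure (\<lambda>x. W t x - W 0 x))\<^sup>2 +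
       2 * (L2_norm space_measure (\<lambda>x. val (w t) x - val (w 0) x))\<^sup>2 < e"
      using e by (intro order_tendstoD) simp_all
    then obtain r where r: "0 < r" and small: "\<And>t. t \<in> {0..T} \<Longrightarrow> t \<noteq> 0 \<Longrightarrow> dist t 0 < r \<Longrightarrow>
       2 * (L2_norm space_measure (\<lambda>x. W t x - W 0 x))\<^sup>2 +
       2 * (L2_norm space_measure (\<lambda>x. val (w t) x - val (w 0) x))\<^sup>2 < e"
      unfolding eventually_at by blast
    have "\<exists>t\<in>{0<..<min r T}. AE x in space_measure. W t x = val (w t) x"
    proof (rule ccontr)
      assume neg: "\<not> ?thesis"
      have "AE t in lebesgue. t \<in> {0<..T} \<longrightarrow> (AE x in space_measure. W t x = val (w t) x)"
        using W by (simp add: P_def AE_restrict_space_iff)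
      then have "AE t in lebesgue. t \<notin> {0<..<min r T}"
        by (rule eventually_mono) (use neg in auto)
      then have "{0<..<min r T} \<in> null_sets lebesgue"
        by (subst (asm) AE_iff_null_sets[symmetric]) auto
      then have "emeasure lebesgue {0<..<min r T} = 0" by blast
      then show False using r T by simp
    qed
    then obtain t where t: "t \<in> {0<..<min r T}" and eq: "AE x in space_measure. W t x = val (w t) x"
      by blast
    from t have "t \<in> {0..T}" "t \<noteq> 0" "dist t 0 < r" by auto
    from le[OF this(1) eq] small[OF this] show "(L2_norm space_measure d)\<^sup>2 \<le> 0 + e" by linarith
  qed
  then have "L2_norm space_measure d = 0" by simp
  from L2_norm_eq_0_AE[OF d2 this]
  show "AE x in space_measure. initial_value \<Omega> T val w x = val (w 0) x"
    by (simp add: d_def iv)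
qed

lemma L2_norm_initial_value:
  assumes T: "0 < T" and w: "continuous_on {0..T} w" and 0: "w 0 = 0"
  shows "L2_norm space_measure (initial_value \<Omega> T val w) = 0"
proof -
  have "AE x in space_measure. initial_value \<Omega> T val w x = 0"
    using initial_value_AE(2)[OF T w] AE_val_0 unfolding 0 by eventually_elim simp
  then have "L2_norm space_measure (initial_value \<Omega> T val w) = L2_norm space_measure (\<lambda>x. 0::real)"
    using L2_spaceD(1)[OF initial_value_AE(1)[OF T w]] by (intro L2_norm_cong_AE) auto
  then show ?thesis by (simp add: L2_norm_def)
qed

lemma L2_inner_val_0: "L2_inner space_measure f (val 0) = 0"
proof -
  have "AE x in space_measure. f x * val 0 x = 0" using AE_val_0 by eventually_elim simp
  then show ?thesis unfolding L2_inner_def by (rule integral_eq_zero_AE)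
qed

end

section \<open>Weak time derivatives of piecewise affine functions\<close>

lemma piecewise_deriv_superset:
  assumes "piecewise_deriv T S w D" "S \<subseteq> S'" "finite S'"
  shows "piecewise_deriv T S' w D"
  using assms unfolding piecewise_deriv_def by blast

lemma orthonormal_expansion_span:
  fixes C :: "'a::real_inner set"
  assumes C: "finite C" "\<And>c d. c \<in> C \<Longrightarrow> d \<in> C \<Longrightarrow> c \<bullet> d = (if c = d then 1 else 0)"
    and v: "v \<in> span C"
  shows "v = (\<Sum>c\<in>C. (v \<bullet> c) *\<^sub>R c)"
  using v
proof (induction rule: span_induct_alt)
  case base
  then show ?case by simp
next
  case (step r x y)
  have "(\<Sum>c\<in>C. (x \<bullet> c) *\<^sub>R c) = (\<Sum>c\<in>C. if c = x then x else 0)"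
    by (rule sum.cong) (use C step in auto)
  also have "\<dots> = x" using C(1) step by simp
  finally have x: "(\<Sum>c\<in>C. (x \<bullet> c) *\<^sub>R c) = x" .
  have "(\<Sum>c\<in>C. ((r *\<^sub>R x + y) \<bullet> c) *\<^sub>R c) = r *\<^sub>R (\<Sum>c\<in>C. (x \<bullet> c) *\<^sub>R c) + (\<Sum>c\<in>C. (y \<bullet> c) *\<^sub>R c)"
    by (simp add: inner_add_left scaleR_add_left sum.distrib scaleR_sum_right)
  then show ?case using x step by simp
qed

text \<open>One step of the Gram-Schmidt process for each vector of the finite generating set.\<close>
lemma finite_span_orthonormal_basis:
  fixes B :: "'a::real_inner set"
  assumes "finite B"
  shows "\<exists>C. finite C \<and> (\<forall>c\<in>C. \<forall>d\<in>C. c \<bullet> d = (if c = d then 1 else 0)) \<and> span C = span B"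
  using assms
proof induction
  case empty
  show ?case by (intro exI[of _ "{}"]) simp
next
  case (insert b B)
  then obtain C where C: "finite C" "\<And>c d. c \<in> C \<Longrightarrow> d \<in> C \<Longrightarrow> c \<bullet> d = (if c = d then 1 else 0)"
    and span: "span C = span B" by blast
  define p where "p = (\<Sum>c\<in>C. (b \<bullet> c) *\<^sub>R c)"
  have p: "p \<in> span C" unfolding p_def by (intro span_sum span_scale span_base)
  have orth: "(b - p) \<bullet> d = 0" if "d \<in> C" for d
  proof -
    have "p \<bullet> d = (\<Sum>c\<in>C. if c = d then b \<bullet> d else 0)"
      unfolding p_def inner_sum_left by (rule sum.cong) (use C that in auto)
    then show ?thesis using C(1) that by (simp add: inner_diff_left)
  qed
  show ?case
  proof (cases "b = p")
    case True
    then have "span (insert b B) = span C" using p span by (metis span_redundant)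
    then show ?thesis using C by blast
  next
    case False
    define c where "c = (b - p) /\<^sub>R norm (b - p)"
    have "norm c = 1" using False by (simp add: c_def)
    then have 1: "c \<bullet> c = 1" by (simp add: dot_square_norm)
    have 2: "c \<bullet> d = 0" "d \<bullet> c = 0" if "d \<in> C" for d
      using orth[OF that] by (simp_all add: c_def inner_commute)
    have eq: "b = norm (b - p) *\<^sub>R c + p" using False by (simp add: c_def)
    have "span (insert c C) = span (insert b C)"
    proof (rule span_eq[THEN iffD2], intro conjI subsetI)
      fix x assume "x \<in> insert c C"
      have "p \<in> span (insert b C)" using p span_mono[of C "insert b C"] by blast
      then have "c \<in> span (insert b C)"
        unfolding c_def by (intro span_scale span_diff) (simp_all add: span_base)
      with \<open>x \<in> insert c C\<close> show "x \<in> span (insert b C)"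
        using span_base[of x "insert b C"] by blast
    next
      fix x assume "x \<in> insert b C"
      have "p \<in> span (insert c C)" using p span_mono[of C "insert c C"] by blast
      then have "b \<in> span (insert c C)"
        by (subst eq) (intro span_add span_scale, simp_all add: span_base)
      with \<open>x \<in> insert b C\<close> show "x \<in> span (insert c C)"
        using span_base[of x "insert c C"] by blast
    qed
    also have "\<dots> = span (insert b B)" using span by (simp add: span_insert)
    finally have "span (insert c C) = span (insert b B)" .
    moreover have "finite (insert c C)" using C by simp
    moreover have "\<forall>x\<in>insert c C. \<forall>y\<in>insert c C. x \<bullet> y = (if x = y then 1 else 0)"
      using C 1 2 by fastforce
    ultimately show ?thesis by blast
  qed
qed

text \<open>
  A finite subset of \<open>W\<close> from which every element of \<open>W\<close> is recovered by its inner products. The coordinates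
  \<open>v \<bullet> c\<close> are continuous in \<open>v\<close>, which carries continuity and measurability over
  to functions with values in \<open>W\<close>; an orthonormal basis is an example.
\<close>
definition finite_frame :: "'a::real_inner set \<Rightarrow> 'a set \<Rightarrow> bool" where
  "finite_frame C W \<longleftrightarrow> finite C \<and> C \<subseteq> W \<and> (\<forall>v\<in>W. v = (\<Sum>c\<in>C. (v \<bullet> c) *\<^sub>R c))"

lemma discrete_space_finite_frame:
  fixes W :: "'v::real_inner set"
  assumes "discrete_space \<Omega> val W"
  obtains C where "finite_frame C W"
proof -
  obtain B where "finite B" "span B = W" using assms by (auto simp: discrete_space_def)
  then obtain C where "finite C" "\<forall>c\<in>C. \<forall>d\<in>C. c \<bullet> d = (if c = d then 1 else 0)" "span C = W"
    using finite_span_orthonormal_basis by metis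
  then have "finite_frame C W"
    using orthonormal_expansion_span[of C] span_superset[of C] by (auto simp: finite_frame_def)
  then show ?thesis using that by blast
qed

lemma time_grid_strict_mono:
  assumes "time_grid T K \<tau>" "j < k" "k \<le> K"
  shows "\<tau> j < \<tau> k"
  using assms(2,3)
proof (induction k)
  case (Suc k)
  then have "\<tau> k < \<tau> (Suc k)" using assms(1) by (force simp: time_grid_def)
  then show ?case using Suc by (cases "j = k") auto
qed simp

lemma time_grid_interval_exists:
  assumes "time_grid T K \<tau>" "t \<in> {0<..T}"
  obtains k where "k \<in> {1..K}" "t \<in> {\<tau> (k - 1)<..\<tau> k}"
proof -
  define k where "k = (LEAST k. t \<le> \<tau> k)"
  have K: "t \<le> \<tau> K" and 0: "\<not> t \<le> \<tau> 0" using assms by (auto simp: time_grid_def)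
  have "t \<le> \<tau> k" unfolding k_def using K by (rule LeastI)
  moreover have "k \<le> K" unfolding k_def using K by (rule Least_le)
  moreover have "k \<noteq> 0" using \<open>t \<le> \<tau> k\<close> 0 by metis
  moreover have "\<not> t \<le> \<tau> (k - 1)" using \<open>k \<noteq> 0\<close> unfolding k_def by (intro not_less_Least) simp
  ultimately show ?thesis by (intro that[of k]) auto
qed

lemma time_grid_interval_unique:
  assumes "time_grid T K \<tau>" "j \<in> {1..K}" "k \<in> {1..K}"
    "t \<in> {\<tau> (j - 1)<..\<tau> j}" "t \<in> {\<tau> (k - 1)<..\<tau> k}"
  shows "j = k"
proof -
  have *: False if "i < l" "i \<in> {1..K}" "l \<in> {1..K}" "t \<le> \<tau> i" "\<tau> (l - 1) < t" for i l
  proof (cases "i = l - 1")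
    case False
    then have "\<tau> i < \<tau> (l - 1)" using that by (intro time_grid_strict_mono[OF assms(1)]) auto
    then show False using that by simp
  qed (use that in auto)
  show ?thesis using *[of j k] *[of k j] assms(2-5) by (cases j k rule: linorder_cases) auto
qed

lemma discrete_trial_space_mem:
  assumes "time_grid T K \<tau>" "subspace W" "w \<in> discrete_trial_space T K \<tau> W" "t \<in> {0<..T}"
  shows "w t \<in> W"
proof -
  obtain k where "k \<in> {1..K}" "t \<in> {\<tau> (k - 1)<..\<tau> k}"
    using time_grid_interval_exists[OF assms(1,4)] .
  then obtain a b where "a \<in> W" "b \<in> W" "w t = a + t *\<^sub>R b"
    using assms(3) unfolding discrete_trial_space_def by blast
  then show ?thesis using assms(2) by (simp add: subspace_add subspace_scale)
qed

text \<open>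
  The derivative is the step function of the slopes. As the grid intervals \<open>(\<tau>\<^sub>k\<^sub>-\<^sub>1, \<tau>\<^sub>k]\<close> are disjoint, it can
  be written as a sum of indicators, which makes measurability evident.
\<close>
lemma discrete_trial_space_piecewise_deriv:
  fixes w :: "real \<Rightarrow> 'v::{real_normed_vector,second_countable_topology}"
  assumes grid: "time_grid T K \<tau>" and w: "w \<in> discrete_trial_space T K \<tau> W"
  shows "\<exists>D. piecewise_deriv T (\<tau> ` {0..K}) w D"
proof -
  have "\<forall>k. \<exists>a b. k \<in> {1..K} \<longrightarrow> (\<forall>t\<in>{\<tau> (k - 1)<..\<tau> k}. w t = a + t *\<^sub>R b)"
    using w unfolding discrete_trial_space_def by blast
  then obtain a b where ab: "\<And>k t. k \<in> {1..K} \<Longrightarrow> t \<in> {\<tau> (k - 1)<..\<tau> k} \<Longrightarrow> w t = a k + t *\<^sub>R b k"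
    by metis
  define D where "D t = (\<Sum>k\<in>{1..K}. indicat_real {\<tau> (k - 1)<..\<tau> k} t *\<^sub>R b k)" for t
  have D: "D t = b k" if k: "k \<in> {1..K}" and t: "t \<in> {\<tau> (k - 1)<..\<tau> k}" for k t
  proof -
    have "D t = (\<Sum>j\<in>{1..K}. if j = k then b k else 0)"
      unfolding D_def
    proof (rule sum.cong[OF refl])
      fix j assume "j \<in> {1..K}"
      then have "t \<in> {\<tau> (j - 1)<..\<tau> j} \<longleftrightarrow> j = k"
        using time_grid_interval_unique[OF grid _ k _ t] t by blast
      then show "indicat_real {\<tau> (j - 1)<..\<tau> j} t *\<^sub>R b j = (if j = k then b k else 0)"
        by (simp only: indicator_def) simp
    qed
    then show ?thesis using k by simp
  qed
  have "D \<in> borel_measurable borel" unfolding D_def by measurable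
  moreover have "(\<lambda>t. t) \<in> time_measure T \<rightarrow>\<^sub>M borel"
    by (intro measurable_restrict_space1 measurable_completion) simp
  ultimately have meas: "D \<in> borel_measurable (time_measure T)" by (rule measurable_compose[rotated])
  have "norm (D t) \<le> (\<Sum>k\<in>{1..K}. norm (b k))" for t
    unfolding D_def by (rule order_trans[OF norm_sum sum_mono]) (simp add: indicator_def)
  then have bdd: "bounded (D ` {0<..T})" by (auto simp: bounded_iff)
  have loc: "(w has_vector_derivative D t) (at t) \<and> isCont D t" if t: "t \<in> {0<..<T} - \<tau> ` {0..K}" for t
  proof -
    obtain k where k: "k \<in> {1..K}" and "t \<in> {\<tau> (k - 1)<..\<tau> k}"
      using time_grid_interval_exists[OF grid, of t] t by auto
    moreover have "t \<noteq> \<tau> k" using t k by auto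
    ultimately have tJ: "t \<in> {\<tau> (k - 1)<..<\<tau> k}" by auto
    have "((\<lambda>t. a k + t *\<^sub>R b k) has_vector_derivative b k) (at t)"
      by (auto intro!: derivative_eq_intros)
    then have "(w has_vector_derivative b k) (at t)"
      by (rule has_vector_derivative_transform_within_open[OF _ _ tJ]) (use ab[OF k] in auto)
    moreover have "continuous_on {\<tau> (k - 1)<..<\<tau> k} D"
      using D[OF k] by (subst continuous_on_cong[OF refl, of _ _ "\<lambda>_. b k"]) auto
    then have "isCont D t" using tJ by (simp add: continuous_on_eq_continuous_at)
    moreover have "D t = b k" using tJ by (intro D[OF k]) auto
    ultimately show ?thesis by simp
  qed
  show ?thesis
    using meas bdd loc w by (intro exI[of _ D]) (auto simp: piecewise_deriv_def discrete_trial_space_def)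
qed

text \<open>
  Expanding \<open>e(t)\<close> over a finite frame reduces measurability of the pairing to that of the scalar functions
  \<open>l(t)(c)\<close>. Joint measurability of the evaluation on \<open>V' \<times> V\<close> is thereby never needed.
\<close>
lemma functional_pairing_integrable:
  fixes l :: "real \<Rightarrow> 'v::real_inner \<Rightarrow>\<^sub>L real"
  assumes l: "l \<in> L2_space (time_measure T)" and e: "continuous_on {0..T} e"
    and C: "finite_frame C W" and W: "\<And>t. t \<in> {0<..T} \<Longrightarrow> e t \<in> W"
  shows "integrable (time_measure T) (\<lambda>t. blinfun_apply (l t) (e t))"
proof (rule L2_dominated_product(1)[OF l continuous_on_L2_space[OF e], where c=1])
  have lc: "(\<lambda>t. blinfun_apply (l t) c) \<in> borel_measurable (time_measure T)" for c
    by (rule measurable_compose[OF L2_spaceD(1)[OF l]])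
       (intro borel_measurable_continuous_onI linear_continuous_on bounded_linear_blinfun_apply bounded_linear_ident
         blinfun.bounded_linear_left)
  have "(\<lambda>t. e t \<bullet> c) \<in> borel_measurable (time_measure T)" for c
    by (rule continuous_on_borel_measurable_time) (intro continuous_intros e)
  with lc have "(\<lambda>t. \<Sum>c\<in>C. (e t \<bullet> c) * blinfun_apply (l t) c) \<in> borel_measurable (time_measure T)"
    by (intro borel_measurable_sum borel_measurable_times)
  moreover have "blinfun_apply (l t) (e t) = (\<Sum>c\<in>C. (e t \<bullet> c) * blinfun_apply (l t) c)"
    if "t \<in> space (time_measure T)" for t
  proof -
    have "e t = (\<Sum>c\<in>C. (e t \<bullet> c) *\<^sub>R c)"
      using C W[of t] that by (auto simp: finite_frame_def space_restrict_space)
    then have "blinfun_apply (l t) (e t) = blinfun_apply (l t) (\<Sum>c\<in>C. (e t \<bullet> c) *\<^sub>R c)" by simp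
    then show ?thesis by (simp add: blinfun.sum_right blinfun.scaleR_right)
  qed
  ultimately show "(\<lambda>t. blinfun_apply (l t) (e t)) \<in> borel_measurable (time_measure T)"
    by (subst measurable_cong)
  show "\<bar>blinfun_apply (l t) (e t)\<bar> \<le> 1 * (norm (l t) * norm (e t))" for t
    using norm_blinfun[of "l t" "e t"] by simp
qed simp

context H1_embedding
begin

lemma piecewise_deriv_weak:
  assumes T: "0 < T" and w: "piecewise_deriv T S w D" and \<phi>: "\<phi> \<in> test_functions {0<..<T}"
  shows "(LINT t|time_measure T. H_inner (w t) \<psi> * deriv \<phi> t) =
    - (LINT t|time_measure T. H_inner (D t) \<psi> * \<phi> t)"
proof (rule integral_by_parts_time)
  show "piecewise_deriv T S (\<lambda>t. H_inner (w t) \<psi>) (\<lambda>t. H_inner (D t) \<psi>)"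
    by (rule piecewise_deriv_bounded_linear[OF H.bounded_linear_left w])
  show "piecewise_deriv T S \<phi> (deriv \<phi>)"
    by (rule piecewise_deriv_superset[OF test_function_piecewise_deriv(1)[OF T \<phi>]])
       (use w in \<open>auto simp: piecewise_deriv_def\<close>)
qed (use test_function_piecewise_deriv[OF T \<phi>] T in auto)

text \<open>
  The chosen time derivative is a weak derivative as soon as some weak derivative exists; the classical
  derivative, acting through the \<open>H\<close> inner product, is one.
\<close>
lemma weak_time_deriv_time_deriv:
  assumes T: "0 < T" and w: "piecewise_deriv T S w D"
  shows "weak_time_deriv \<Omega> T val w (time_deriv \<Omega> T val w)"
proof -
  obtain B where B: "\<And>t. t \<in> {0<..T} \<Longrightarrow> norm (D t) \<le> B" "0 \<le> B"
    using piecewise_deriv_bound[OF w] by blast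
  obtain L where L: "\<And>v. norm (H.prod_right v) \<le> norm v * L" "0 \<le> L"
    using bounded_linear.nonneg_bounded[OF H.bounded_linear_prod_right] by blast
  have "H.prod_right \<in> borel_measurable borel"
    by (intro borel_measurable_continuous_onI linear_continuous_on H.bounded_linear_prod_right)
  then have "(\<lambda>t. H.prod_right (D t)) \<in> borel_measurable (time_measure T)"
    using w by (auto simp: piecewise_deriv_def intro: measurable_compose)
  moreover have "norm (H.prod_right (D t)) \<le> B * L" if "t \<in> {0<..T}" for t
    using B(1)[OF that] L by (meson mult_right_mono order_trans)
  ultimately have "(\<lambda>t. H.prod_right (D t)) \<in> L2_space (time_measure T)"
    by (rule bounded_measurable_L2_space_time)
  then have "weak_time_deriv \<Omega> T val w (\<lambda>t. H.prod_right (D t))"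
    using piecewise_deriv_weak[OF T w] by (simp add: weak_time_deriv_def H_inner_def)
  then show ?thesis unfolding time_deriv_def by (rule someI[where P="weak_time_deriv \<Omega> T val w"])
qed

lemma H_inner_deriv_integrable:
  assumes w: "piecewise_deriv T S w D" and e: "continuous_on {0..T} e"
  shows "integrable (time_measure T) (\<lambda>t. H_inner (D t) (e t))"
proof -
  obtain A where A: "\<And>t. t \<in> {0<..T} \<Longrightarrow> norm (D t) \<le> A" "0 \<le> A"
    using piecewise_deriv_bound[OF w] by blast
  obtain B where B: "\<And>t. t \<in> {0..T} \<Longrightarrow> norm (e t) \<le> B" "0 \<le> B"
    using continuous_on_bounded_time[OF e] by blast
  obtain L where L: "\<And>v w. norm (H_inner v w) \<le> norm v * norm w * L" "0 \<le> L"
    using H.nonneg_bounded by blast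
  have [measurable]: "D \<in> borel_measurable (time_measure T)" "e \<in> borel_measurable (time_measure T)"
    using w continuous_on_borel_measurable_time[OF e] by (auto simp: piecewise_deriv_def)
  have "continuous_on UNIV (\<lambda>x. H_inner (fst x) (snd x))"
    by (intro H.continuous_on continuous_intros)
  then have "(\<lambda>t. H_inner (D t) (e t)) \<in> borel_measurable (time_measure T)"
    by (rule borel_measurable_continuous_Pair[rotated 2]) measurable
  moreover have "norm (H_inner (D t) (e t)) \<le> A * B * L" if "t \<in> {0<..T}" for t
    using A B L that
    by (intro order_trans[OF L(1)] mult_right_mono mult_mono) auto
  ultimately show ?thesis by (rule bounded_measurable_time_integrable)
qed

text \<open>
  For a fixed vector \<open>c\<close>, the scalar function \<open>\<langle>w'(t), c\<rangle> - (D(t), c)\<^sub>H\<close> has integral zero against every test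
  function, hence also against the piecewise smooth coordinate \<open>e(t) \<bullet> c\<close>. Summing over the finite frame
  gives the claim.
\<close>
lemma weak_time_deriv_pairing:
  assumes T: "0 < T" and w: "piecewise_deriv T S w D" and w': "weak_time_deriv \<Omega> T val w w'"
    and e: "piecewise_deriv T S' e E" and C: "finite_frame C W"
    and W: "\<And>t. t \<in> {0<..T} \<Longrightarrow> e t \<in> W"
  shows "(LINT t|time_measure T. blinfun_apply (w' t) (e t)) = (LINT t|time_measure T. H_inner (D t) (e t))"
proof -
  have L2: "w' \<in> L2_space (time_measure T)" using w' by (simp add: weak_time_deriv_def)
  define h where "h c t = blinfun_apply (w' t) c - H_inner (D t) c" for c t
  have iw: "integrable (time_measure T) (\<lambda>t. blinfun_apply (w' t) c)" if "c \<in> W" for c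
    by (rule functional_pairing_integrable[OF L2 _ C]) (use that in auto)
  have iD: "integrable (time_measure T) (\<lambda>t. H_inner (D t) c)" for c
    by (rule H_inner_deriv_integrable[OF w]) simp
  have ih: "integrable (time_measure T) (h c)" if "c \<in> W" for c
    unfolding h_def by (intro Bochner_Integration.integrable_diff iw iD that)
  have prod: "integrable (time_measure T) (\<lambda>t. k t * \<phi> t)"
    if k: "integrable (time_measure T) k" and \<phi>: "continuous_on {0..T} \<phi>" for k \<phi> :: "real \<Rightarrow> real"
  proof -
    obtain b where b: "\<And>t. t \<in> {0..T} \<Longrightarrow> norm (\<phi> t) \<le> b" "0 \<le> b"
      using continuous_on_bounded_time[OF \<phi>] by blast
    show ?thesis
    proof (rule Bochner_Integration.integrable_bound)
      show "integrable (time_measure T) (\<lambda>t. k t * b)" using k by simp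
      show "(\<lambda>t. k t * \<phi> t) \<in> borel_measurable (time_measure T)"
        using k continuous_on_borel_measurable_time[OF \<phi>] by simp
      show "AE t in time_measure T. norm (k t * \<phi> t) \<le> norm (k t * b)"
        by (rule AE_I2) (use b in \<open>auto simp: abs_mult space_restrict_space intro!: mult_left_mono\<close>)
    qed
  qed
  have ec: "continuous_on {0..T} (\<lambda>t. e t \<bullet> c)" for c
    using e by (auto simp: piecewise_deriv_def intro!: continuous_intros)
  have zero: "(LINT t|time_measure T. h c t * (e t \<bullet> c)) = 0" if c: "c \<in> W" for c
  proof (rule test_functions_determine_integral[OF T ih[OF c]])
    fix \<phi> assume \<phi>: "\<phi> \<in> test_functions {0<..<T}"
    have c\<phi>: "continuous_on {0..T} \<phi>"
      using test_function_piecewise_deriv(1)[OF T \<phi>] by (simp add: piecewise_deriv_def)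
    have "(LINT t|time_measure T. H_inner (w t) c * deriv \<phi> t) = - (LINT t|time_measure T. blinfun_apply (w' t) c * \<phi> t)"
      using w' \<phi> by (simp add: weak_time_deriv_def H_inner_def)
    with piecewise_deriv_weak[OF T w \<phi>, of c]
    show "(LINT t|time_measure T. h c t * \<phi> t) = 0"
      using prod[OF iw[OF c] c\<phi>] prod[OF iD c\<phi>] by (simp add: h_def left_diff_distrib)
  next
    show "piecewise_deriv T S' (\<lambda>t. e t \<bullet> c) (\<lambda>t. E t \<bullet> c)"
      by (rule piecewise_deriv_bounded_linear[OF bounded_linear_inner_left e])
  qed
  have expand: "F (e t) = (\<Sum>c\<in>C. F c * (e t \<bullet> c))"
    if "t \<in> {0<..T}" "bounded_linear F" for F :: "'v \<Rightarrow> real" and t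
  proof -
    have "e t = (\<Sum>c\<in>C. (e t \<bullet> c) *\<^sub>R c)" using C W[OF that(1)] by (simp add: finite_frame_def)
    then have "F (e t) = F (\<Sum>c\<in>C. (e t \<bullet> c) *\<^sub>R c)" by simp
    then show ?thesis
      using that(2) by (simp add: linear_sum linear_scale bounded_linear.linear mult.commute)
  qed
  have CW: "C \<subseteq> W" using C by (simp add: finite_frame_def)
  have "(LINT t|time_measure T. blinfun_apply (w' t) (e t)) =
      (LINT t|time_measure T. (\<Sum>c\<in>C. blinfun_apply (w' t) c * (e t \<bullet> c)))"
    by (rule Bochner_Integration.integral_cong)
       (simp_all add: expand[OF _ blinfun.bounded_linear_right] space_restrict_space)
  also have "\<dots> = (\<Sum>c\<in>C. (LINT t|time_measure T. blinfun_apply (w' t) c * (e t \<bullet> c)))"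
    by (rule Bochner_Integration.integral_sum) (rule prod[OF iw ec], use CW in auto)
  also have "\<dots> = (\<Sum>c\<in>C. (LINT t|time_measure T. H_inner (D t) c * (e t \<bullet> c)))"
  proof (rule sum.cong[OF refl])
    fix c assume "c \<in> C"
    with CW have c: "c \<in> W" by blast
    from zero[OF c] show "(LINT t|time_measure T. blinfun_apply (w' t) c * (e t \<bullet> c)) =
        (LINT t|time_measure T. H_inner (D t) c * (e t \<bullet> c))"
      using prod[OF iw[OF c] ec] prod[OF iD ec] by (simp add: h_def left_diff_distrib)
  qed
  also have "\<dots> = (LINT t|time_measure T. (\<Sum>c\<in>C. H_inner (D t) c * (e t \<bullet> c)))"
    by (rule Bochner_Integration.integral_sum[symmetric]) (rule prod[OF iD ec])
  also have "\<dots> = (LINT t|time_measure T. H_inner (D t) (e t))"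
    by (rule Bochner_Integration.integral_cong)
       (simp_all add: expand[OF _ H.bounded_linear_right] space_restrict_space)
  finally show ?thesis .
qed

text \<open>The derivative of the squared \<open>H\<close> norm of \<open>e\<close> is \<open>2 (e', e)\<^sub>H\<close>.\<close>
lemma energy_identity:
  assumes T: "0 < T" and e: "piecewise_deriv T S e E"
  shows "(LINT t|time_measure T. H_inner (E t) (e t)) = (H_inner (e T) (e T) - H_inner (e 0) (e 0)) / 2"
proof -
  have ce: "continuous_on {0..T} e" using e by (simp add: piecewise_deriv_def)
  have "(LINT t|time_measure T. H_inner (E t) (e t)) = H_inner (e T) (e T) / 2 - H_inner (e 0) (e 0) / 2"
  proof (rule integral_deriv_time)
    show "continuous_on {0..T} (\<lambda>t. H_inner (e t) (e t) / 2)"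
      by (intro continuous_intros H.continuous_on ce) simp
    fix t assume "t \<in> {0<..<T} - S"
    then have "(e has_vector_derivative E t) (at t)" using e by (simp add: piecewise_deriv_def)
    from has_vector_derivative_divide[OF H.has_vector_derivative[OF this this], of 2]
    show "((\<lambda>t. H_inner (e t) (e t) / 2) has_vector_derivative H_inner (E t) (e t)) (at t)"
      by (simp add: H_inner_commute[of "e t" "E t"])
  qed (use T e H_inner_deriv_integrable[OF e ce] in \<open>auto simp: piecewise_deriv_def\<close>)
  then show ?thesis by (simp add: diff_divide_distrib)
qed

end

section \<open>Quasilinear forms and interpolated coefficients\<close>

text \<open>
  The Lipschitz condition bounds the change in the first two arguments. It also bounds the change in the
  last one: by linearity that change is \<open>a[u](u, e - e')\<close>, which is compared with \<open>a[0](0, e - e') = 0\<close>.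
\<close>
lemma Lipschitz_form_continuous_on:
  fixes a :: "'v::real_normed_vector \<Rightarrow> 'v \<Rightarrow> 'v \<Rightarrow> real"
  assumes Lip: "Lipschitz_form a L" and zero: "\<And>v. a 0 0 v = 0"
    and diff: "\<And>u v w. a u u (v - w) = a u u v - a u u w"
    and u: "continuous_on X u" and e: "continuous_on X e"
  shows "continuous_on X (\<lambda>t. a (u t) (u t) (e t))"
  unfolding continuous_on_def
proof
  fix t assume t: "t \<in> X"
  have ut: "(u \<longlongrightarrow> u t) (at t within X)" and et: "(e \<longlongrightarrow> e t) (at t within X)"
    using u e t by (auto simp: continuous_on_def)
  have lip: "\<bar>a v v z - a w w z\<bar> \<le> L * norm (v - w) * norm z" for v w z
    using Lip by (simp add: Lipschitz_form_def)
  have bound: "norm (a (u s) (u s) (e s) - a (u t) (u t) (e t)) \<le>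
      L * norm (u s - u t) * norm (e s) + L * norm (u t) * norm (e s - e t)" for s
  proof -
    have "\<bar>a (u t) (u t) (e s - e t)\<bar> \<le> L * norm (u t) * norm (e s - e t)"
      using lip[of "u t" "e s - e t" 0] by (simp add: zero)
    then show ?thesis
      using lip[of "u s" "e s" "u t"] diff[of "u t" "e s" "e t"] by simp
  qed
  have "((\<lambda>s. L * norm (u s - u t) * norm (e s) + L * norm (u t) * norm (e s - e t)) \<longlongrightarrow>
      L * norm (u t - u t) * norm (e t) + L * norm (u t) * norm (e t - e t)) (at t within X)"
    by (intro tendsto_intros ut et)
  then have lim: "((\<lambda>s. L * norm (u s - u t) * norm (e s) + L * norm (u t) * norm (e s - e t)) \<longlongrightarrow> 0) (at t within X)"
    by simp
  have "((\<lambda>s. a (u s) (u s) (e s) - a (u t) (u t) (e t)) \<longlongrightarrow> 0) (at t within X)"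
    by (rule Lim_null_comparison[OF always_eventually lim]) (use bound in blast)
  then show "((\<lambda>s. a (u s) (u s) (e s)) \<longlongrightarrow> a (u t) (u t) (e t)) (at t within X)"
    by (rule LIM_zero_cancel)
qed

lemma discrete_space_val_sum:
  assumes W: "discrete_space \<Omega> val W" and x: "x \<in> \<Omega>" and C: "finite C" "C \<subseteq> W"
  shows "val (\<Sum>c\<in>C. f c *\<^sub>R c) x = (\<Sum>c\<in>C. f c * val c x)"
  using C
proof induction
  have sub: "subspace W" and lin: "\<And>v w a b. v \<in> W \<Longrightarrow> w \<in> W \<Longrightarrow>
      val (a *\<^sub>R v + b *\<^sub>R w) x = a * val v x + b * val w x"
    using W x by (auto simp: discrete_space_def)
  case empty
  show ?case using lin[of 0 0 0 0] subspace_0[OF sub] by simp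
next
  have sub: "subspace W" and lin: "\<And>v w a b. v \<in> W \<Longrightarrow> w \<in> W \<Longrightarrow>
      val (a *\<^sub>R v + b *\<^sub>R w) x = a * val v x + b * val w x"
    using W x by (auto simp: discrete_space_def)
  case (insert c C)
  have "(\<Sum>c\<in>C. f c *\<^sub>R c) \<in> W"
    using insert sub by (intro subspace_sum subspace_scale) auto
  with lin[of c "\<Sum>c\<in>C. f c *\<^sub>R c" "f c" 1] insert show ?case by simp
qed

text \<open>
  Point evaluation need not be continuous on \<open>V\<close>, but it is on a finite-dimensional subspace on which it
  is linear.
\<close>
lemma discrete_space_val_continuous_on:
  fixes W :: "'v::real_inner set"
  assumes W: "discrete_space \<Omega> val W" and x: "x \<in> \<Omega>"
  shows "continuous_on W (\<lambda>v. val v x)"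
proof -
  obtain C where C: "finite_frame C W" using discrete_space_finite_frame[OF W] .
  have "val v x = (\<Sum>c\<in>C. (v \<bullet> c) * val c x)" if "v \<in> W" for v
  proof -
    have "v = (\<Sum>c\<in>C. (v \<bullet> c) *\<^sub>R c)" using C that by (simp add: finite_frame_def)
    then have "val v x = val (\<Sum>c\<in>C. (v \<bullet> c) *\<^sub>R c) x" by simp
    also have "\<dots> = (\<Sum>c\<in>C. (v \<bullet> c) * val c x)"
      by (rule discrete_space_val_sum[OF W x]) (use C in \<open>auto simp: finite_frame_def\<close>)
    finally show ?thesis .
  qed
  moreover have "continuous_on W (\<lambda>v. \<Sum>c\<in>C. (v \<bullet> c) * val c x)"
    by (intro continuous_intros)
  ultimately show ?thesis by (simp cong: continuous_on_cong)
qed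

text \<open>
  The interpolant depends on \<open>f\<close> only through these weights, and these only through the values of \<open>f\<close> at the
  interpolation points.
\<close>
definition eim_weight ::
  "nat \<Rightarrow> (nat \<Rightarrow> 'x \<Rightarrow> real) \<Rightarrow> (nat \<Rightarrow> 'x) \<Rightarrow> (real \<Rightarrow> real) \<Rightarrow> nat \<Rightarrow> ('x \<Rightarrow> real) \<Rightarrow> real" where
  "eim_weight n q p \<nu> m f = (\<Sum>i=1..n. inverse_mat n (\<lambda>i j. q j (p i)) m i * \<nu> (f (p i)))"

lemma eim_coefficient_weights:
  "eim_coefficient n q p \<nu> f x = (\<Sum>m=1..n. eim_weight n q p \<nu> m f * q m x)"
  by (simp add: eim_coefficient_def interpolant_def eim_weight_def superpose_def)

context H1_embedding
begin

lemma weighted_grad_integrable: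
  assumes "\<kappa> \<in> borel_measurable space_measure" "\<And>x. x \<in> \<Omega> \<Longrightarrow> \<bar>\<kappa> x\<bar> \<le> c" "0 \<le> c"
  shows "integrable space_measure (\<lambda>x. \<kappa> x * (grad v x \<bullet> grad w x))"
proof (rule L2_dominated_product(1)[OF grad_L2 grad_L2 _ assms(3)])
  show "(\<lambda>x. \<kappa> x * (grad v x \<bullet> grad w x)) \<in> borel_measurable space_measure"
    using assms(1) by measurable
  show "\<bar>\<kappa> x * (grad v x \<bullet> grad w x)\<bar> \<le> c * (norm (grad v x) * norm (grad w x))"
    if "x \<in> space space_measure" for x
    using assms(2)[of x] assms(3) that unfolding abs_mult
    by (intro mult_mono Cauchy_Schwarz_ineq2) (auto simp: space_restrict_space)
qed

lemma weighted_grad_bounded_bilinear: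
  assumes "\<kappa> \<in> borel_measurable space_measure" "\<And>x. x \<in> \<Omega> \<Longrightarrow> \<bar>\<kappa> x\<bar> \<le> c" "0 \<le> c"
  shows "bounded_bilinear (\<lambda>v w. LINT x|space_measure. \<kappa> x * (grad v x \<bullet> grad w x))"
  by (rule bounded_bilinear_weighted[OF grad_L2 AE_grad_lin _ assms, of 1]) (simp add: grad_norm_le)

lemma quasilinear_form_0: "quasilinear_form \<Omega> val grad \<kappa> u 0 v = 0"
  unfolding quasilinear_form_def
  by (rule integral_eq_zero_AE) (use AE_grad_0 in \<open>auto elim: eventually_mono\<close>)

lemma quasilinear_form_diff:
  assumes int: "\<And>v. integrable space_measure (\<lambda>x. \<kappa> (val u) x * (grad u x \<bullet> grad v x))"
  shows "quasilinear_form \<Omega> val grad \<kappa> u u (v - w) =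
    quasilinear_form \<Omega> val grad \<kappa> u u v - quasilinear_form \<Omega> val grad \<kappa> u u w"
proof -
  have "(LINT x|space_measure. \<kappa> (val u) x * (grad u x \<bullet> grad (v - w) x)) =
    (LINT x|space_measure. \<kappa> (val u) x * (grad u x \<bullet> grad v x) - \<kappa> (val u) x * (grad u x \<bullet> grad w x))"
  proof (rule integral_cong_AE)
    show "AE x in space_measure. \<kappa> (val u) x * (grad u x \<bullet> grad (v - w) x) =
      \<kappa> (val u) x * (grad u x \<bullet> grad v x) - \<kappa> (val u) x * (grad u x \<bullet> grad w x)"
      using AE_grad_diff[of v w] by eventually_elim (simp only: inner_diff_right right_diff_distrib)
  qed (use int in auto)
  then show ?thesis using int by (simp add: quasilinear_form_def)
qed

text \<open>
  The pointwise bound on the coefficients meets the gradient seminorms, which the norm of \<open>V\<close> dominates with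
  constant one; this is why no constant appears in front of \<open>\<delta>\<^sub>M\<close> in the error bound.
\<close>
lemma quasilinear_form_perturbation:
  assumes i1: "integrable space_measure (\<lambda>x. \<kappa>1 (val u) x * (grad u x \<bullet> grad v x))"
    and i2: "integrable space_measure (\<lambda>x. \<kappa>2 (val u) x * (grad u x \<bullet> grad v x))"
    and le: "\<And>x. x \<in> \<Omega> \<Longrightarrow> \<bar>\<kappa>1 (val u) x - \<kappa>2 (val u) x\<bar> \<le> \<delta>" and \<delta>: "0 \<le> \<delta>"
  shows "\<bar>quasilinear_form \<Omega> val grad \<kappa>1 u u v - quasilinear_form \<Omega> val grad \<kappa>2 u u v\<bar> \<le> \<delta> * (norm u * norm v)"
proof -
  let ?F = "\<lambda>x. \<kappa>1 (val u) x * (grad u x \<bullet> grad v x) - \<kappa>2 (val u) x * (grad u x \<bullet> grad v x)"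
  have "\<bar>LINT x|space_measure. ?F x\<bar> \<le>
    \<delta> * (L2_norm space_measure (grad u) * L2_norm space_measure (grad v))"
  proof (rule L2_dominated_product(2)[OF grad_L2 grad_L2 _ \<delta>])
    show "?F \<in> borel_measurable space_measure" using i1 i2 by simp
    fix x assume "x \<in> space space_measure"
    then have "\<bar>\<kappa>1 (val u) x - \<kappa>2 (val u) x\<bar> * \<bar>grad u x \<bullet> grad v x\<bar> \<le> \<delta> * (norm (grad u x) * norm (grad v x))"
      using le \<delta> by (intro mult_mono Cauchy_Schwarz_ineq2) (auto simp: space_restrict_space)
    then show "\<bar>?F x\<bar> \<le> \<delta> * (norm (grad u x) * norm (grad v x))"
      by (simp add: abs_mult[symmetric] left_diff_distrib)
  qed
  also have "\<dots> \<le> \<delta> * (norm u * norm v)"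
    using \<delta> by (intro mult_left_mono mult_mono grad_norm_le L2_norm_nonneg) auto
  finally show ?thesis using i1 i2 by (simp add: quasilinear_form_def)
qed

text \<open>
  The bound holds because \<open>q\<^sub>m\<close> is the residual of step \<open>m\<close> divided by its maximal value. Measurability is an
  induction over the greedy steps: each residual combines the composition of \<open>\<nu>\<close> with a snapshot and the
  earlier basis functions.
\<close>
lemma eim_basis_properties:
  assumes eim: "eim_construction \<Omega> val D \<nu> K \<tau> u M q p"
    and cont: "\<And>\<mu>. \<mu> \<in> D \<Longrightarrow> continuous_on UNIV (\<nu> \<mu>)" and m: "m \<in> {1..M}"
  shows "p m \<in> \<Omega>" "q m \<in> borel_measurable space_measure" "\<And>x. x \<in> \<Omega> \<Longrightarrow> \<bar>q m x\<bar> \<le> 1"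
proof -
  obtain \<mu>s ks where step: "\<And>m. m \<in> {1..M} \<Longrightarrow> \<mu>s m \<in> D \<and>
    (let r = (\<lambda>x. superpose (\<nu> (\<mu>s m)) (val (u (\<mu>s m) (\<tau> (ks m)))) x
                - eim_coefficient (m - 1) q p (\<nu> (\<mu>s m)) (val (u (\<mu>s m) (\<tau> (ks m)))) x)
     in p m \<in> \<Omega> \<and> (\<forall>x\<in>\<Omega>. \<bar>r x\<bar> \<le> \<bar>r (p m)\<bar>) \<and> r (p m) \<noteq> 0 \<and> (\<forall>x\<in>\<Omega>. q m x = r x / r (p m)))"
    using eim unfolding eim_construction_def Let_def by blast
  define r where "r m x = superpose (\<nu> (\<mu>s m)) (val (u (\<mu>s m) (\<tau> (ks m)))) x
    - eim_coefficient (m - 1) q p (\<nu> (\<mu>s m)) (val (u (\<mu>s m) (\<tau> (ks m)))) x" for m x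
  have step: "\<mu>s m \<in> D" "p m \<in> \<Omega>" "\<And>x. x \<in> \<Omega> \<Longrightarrow> \<bar>r m x\<bar> \<le> \<bar>r m (p m)\<bar>" "r m (p m) \<noteq> 0"
    "\<And>x. x \<in> \<Omega> \<Longrightarrow> q m x = r m x / r m (p m)" if "m \<in> {1..M}" for m
    using step[OF that] unfolding Let_def r_def by auto
  show "p m \<in> \<Omega>" by (rule step(2)[OF m])
  show "\<bar>q m x\<bar> \<le> 1" if "x \<in> \<Omega>" for x
    using step(3,4,5)[OF m] that by (simp add: divide_le_eq)
  show "q m \<in> borel_measurable space_measure"
    using m
  proof (induction m rule: less_induct)
    case (less m)
    have [measurable]: "\<nu> (\<mu>s m) \<in> borel_measurable borel"
      by (rule borel_measurable_continuous_onI[OF cont[OF step(1)[OF less.prems]]])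
    have "q j \<in> borel_measurable space_measure" if "j \<in> {1..m - 1}" for j
      using less that by auto
    then have "(\<lambda>x. \<Sum>j=1..m - 1. eim_weight (m - 1) q p (\<nu> (\<mu>s m)) j (val (u (\<mu>s m) (\<tau> (ks m)))) * q j x)
        \<in> borel_measurable space_measure"
      by (intro borel_measurable_sum borel_measurable_times) auto
    then have "r m \<in> borel_measurable space_measure"
      unfolding r_def superpose_def eim_coefficient_weights by measurable
    then have "(\<lambda>x. r m x / r m (p m)) \<in> borel_measurable space_measure" by measurable
    then show ?case
      by (subst measurable_cong) (use step(5)[OF less.prems] in \<open>auto simp: space_restrict_space\<close>)
  qed
qed

lemma
  assumes q: "\<And>m. m \<in> {1..M} \<Longrightarrow> q m \<in> borel_measurable space_measure"
    "\<And>m x. m \<in> {1..M} \<Longrightarrow> x \<in> \<Omega> \<Longrightarrow> \<bar>q m x\<bar> \<le> 1"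
  shows eim_form_integrable:
    "integrable space_measure (\<lambda>x. eim_coefficient M q p \<nu> f x * (grad v x \<bullet> grad w x))"
  and eim_form_expansion:
    "quasilinear_form \<Omega> val grad (eim_coefficient M q p \<nu>) u v w =
      (\<Sum>m=1..M. eim_weight M q p \<nu> m (val u) * (LINT x|space_measure. q m x * (grad v x \<bullet> grad w x)))"
proof -
  have int: "integrable space_measure (\<lambda>x. q m x * (grad v x \<bullet> grad w x))" if "m \<in> {1..M}" for m
    by (rule weighted_grad_integrable[OF q(1)[OF that] q(2)[OF that]]) auto
  have eq: "eim_coefficient M q p \<nu> f x * (grad v x \<bullet> grad w x) =
    (\<Sum>m=1..M. eim_weight M q p \<nu> m f * (q m x * (grad v x \<bullet> grad w x)))" for f x
    by (simp add: eim_coefficient_weights sum_distrib_right mult.assoc)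
  have ints: "integrable space_measure (\<lambda>x. eim_weight M q p \<nu> m f * (q m x * (grad v x \<bullet> grad w x)))"
    if "m \<in> {1..M}" for m f
    using int[OF that] by (rule integrable_mult_right)
  show "integrable space_measure (\<lambda>x. eim_coefficient M q p \<nu> f x * (grad v x \<bullet> grad w x))"
    unfolding eq by (rule Bochner_Integration.integrable_sum) (rule ints)
  have "quasilinear_form \<Omega> val grad (eim_coefficient M q p \<nu>) u v w =
    (\<Sum>m=1..M. (LINT x|space_measure. eim_weight M q p \<nu> m (val u) * (q m x * (grad v x \<bullet> grad w x))))"
    unfolding quasilinear_form_def eq by (rule Bochner_Integration.integral_sum) (rule ints)
  then show "quasilinear_form \<Omega> val grad (eim_coefficient M q p \<nu>) u v w =
      (\<Sum>m=1..M. eim_weight M q p \<nu> m (val u) * (LINT x|space_measure. q m x * (grad v x \<bullet> grad w x)))"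
    by simp
qed

text \<open>
  The interpolated form is a sum of products of a weight, continuous in time since point values are, and a
  bounded bilinear form with the fixed weight \<open>q\<^sub>m\<close>.
\<close>
lemma eim_form_continuous_on:
  assumes q: "\<And>m. m \<in> {1..M} \<Longrightarrow> q m \<in> borel_measurable space_measure"
    "\<And>m x. m \<in> {1..M} \<Longrightarrow> x \<in> \<Omega> \<Longrightarrow> \<bar>q m x\<bar> \<le> 1"
    and p: "\<And>m. m \<in> {1..M} \<Longrightarrow> p m \<in> \<Omega>" and \<nu>: "continuous_on UNIV \<nu>"
    and W: "discrete_space \<Omega> val W"
    and u: "continuous_on X u" "\<And>t. t \<in> X \<Longrightarrow> u t \<in> W" and e: "continuous_on X e"
  shows "continuous_on X (\<lambda>t. quasilinear_form \<Omega> val grad (eim_coefficient M q p \<nu>) (u t) (u t) (e t))"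
proof (subst eim_form_expansion[OF q])
  show "continuous_on X (\<lambda>t. \<Sum>m=1..M. eim_weight M q p \<nu> m (val (u t)) *
      (LINT x|space_measure. q m x * (grad (u t) x \<bullet> grad (e t) x)))"
  proof (intro continuous_on_sum continuous_on_mult)
  fix m assume m: "m \<in> {1..M}"
  have v: "continuous_on X (\<lambda>t. val (u t) x)" if "x \<in> \<Omega>" for x
    by (rule continuous_on_compose2[OF discrete_space_val_continuous_on[OF W that] u(1)]) (use u(2) in auto)
  show "continuous_on X (\<lambda>t. eim_weight M q p \<nu> m (val (u t)))"
    unfolding eim_weight_def
    by (intro continuous_on_sum continuous_on_mult continuous_on_const
        continuous_on_compose2[OF \<nu> v] p) auto
  show "continuous_on X (\<lambda>t. LINT x|space_measure. q m x * (grad (u t) x \<bullet> grad (e t) x))"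
    by (rule bounded_bilinear.continuous_on[OF weighted_grad_bounded_bilinear[OF q(1)[OF m] q(2)[OF m]] u(1) e]) auto
  qed
qed auto

text \<open>
  If the coefficient error is infinite, the right-hand side is infinite too, as \<open>e\<close> is not zero, unless \<open>u\<close> vanishes almost
  everywhere, and then the convention \<open>\<infinity> \<cdot> 0 = 0\<close> is the right one because both forms are zero along \<open>u\<close>.
\<close>
lemma coefficient_error_integral:
  assumes i1: "\<And>u v. integrable space_measure (\<lambda>x. \<kappa>1 (val u) x * (grad u x \<bullet> grad v x))"
    and i2: "\<And>u v. integrable space_measure (\<lambda>x. \<kappa>2 (val u) x * (grad u x \<bullet> grad v x))"
    and u: "u \<in> L2_space (time_measure T)" and e: "e \<in> L2_space (time_measure T)"
    and e0: "L2_norm (time_measure T) e \<noteq> 0"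
    and meas: "(\<lambda>t. quasilinear_form \<Omega> val grad \<kappa>1 (u t) (u t) (e t)
      - quasilinear_form \<Omega> val grad \<kappa>2 (u t) (u t) (e t)) \<in> borel_measurable (time_measure T)"
  shows "ennreal \<bar>LINT t|time_measure T. quasilinear_form \<Omega> val grad \<kappa>1 (u t) (u t) (e t)
      - quasilinear_form \<Omega> val grad \<kappa>2 (u t) (u t) (e t)\<bar>
    \<le> coefficient_error \<Omega> T val \<kappa>1 \<kappa>2 u * ennreal (L2_norm (time_measure T) u) * ennreal (L2_norm (time_measure T) e)"
proof (cases "coefficient_error \<Omega> T val \<kappa>1 \<kappa>2 u = top")
  case True
  show ?thesis
  proof (cases "L2_norm (time_measure T) u = 0")
    case u0: True
    have "AE t in time_measure T. u t = 0" by (rule L2_norm_eq_0_AE[OF u u0])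
    then have "AE t in time_measure T. quasilinear_form \<Omega> val grad \<kappa>1 (u t) (u t) (e t)
      - quasilinear_form \<Omega> val grad \<kappa>2 (u t) (u t) (e t) = 0"
      by eventually_elim (simp add: quasilinear_form_0)
    then have "(LINT t|time_measure T. quasilinear_form \<Omega> val grad \<kappa>1 (u t) (u t) (e t)
      - quasilinear_form \<Omega> val grad \<kappa>2 (u t) (u t) (e t)) = 0"
      by (rule integral_eq_zero_AE)
    then show ?thesis by simp
  next
    case False
    then have "0 < L2_norm (time_measure T) u" "0 < L2_norm (time_measure T) e"
      using e0 L2_norm_nonneg[of "time_measure T" u] L2_norm_nonneg[of "time_measure T" e] by linarith+
    then show ?thesis unfolding True by (simp add: ennreal_top_mult)
  qed
next
  case False
  then obtain \<delta> where \<delta>: "0 \<le> \<delta>" "coefficient_error \<Omega> T val \<kappa>1 \<kappa>2 u = ennreal \<delta>"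
    by (cases "coefficient_error \<Omega> T val \<kappa>1 \<kappa>2 u") auto
  have le: "\<bar>\<kappa>1 (val (u t)) x - \<kappa>2 (val (u t)) x\<bar> \<le> \<delta>" if "t \<in> {0<..T}" "x \<in> \<Omega>" for t x
  proof -
    have "ennreal \<bar>\<kappa>1 (val (u t)) x - \<kappa>2 (val (u t)) x\<bar> \<le> coefficient_error \<Omega> T val \<kappa>1 \<kappa>2 u"
      unfolding coefficient_error_def
      by (rule SUP_upper2[OF that(1)], rule SUP_upper[OF that(2)])
    then show ?thesis using \<delta> by simp
  qed
  have "\<bar>LINT t|time_measure T. quasilinear_form \<Omega> val grad \<kappa>1 (u t) (u t) (e t)
      - quasilinear_form \<Omega> val grad \<kappa>2 (u t) (u t) (e t)\<bar>
    \<le> \<delta> * (L2_norm (time_measure T) u * L2_norm (time_measure T) e)"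
  proof (rule L2_dominated_product(2)[OF u e meas \<delta>(1)])
    fix t assume "t \<in> space (time_measure T)"
    then show "\<bar>quasilinear_form \<Omega> val grad \<kappa>1 (u t) (u t) (e t)
      - quasilinear_form \<Omega> val grad \<kappa>2 (u t) (u t) (e t)\<bar> \<le> \<delta> * (norm (u t) * norm (e t))"
      by (intro quasilinear_form_perturbation i1 i2 le \<delta>(1)) (auto simp: space_restrict_space)
  qed
  from ennreal_leI[OF this] show ?thesis
    using \<delta> by (simp add: ennreal_mult L2_norm_nonneg mult.assoc)
qed

lemma residual_le_dual_norm:
  assumes e: "e \<in> L2_space (time_measure T)"
    and e0: "L2_norm (time_measure T) e \<noteq> 0"
  shows "ennreal \<bar>R (e, val 0)\<bar> \<le> test_dual_norm \<Omega> T R * ennreal (L2_norm (time_measure T) e)"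
proof -
  have "L2_norm space_measure (val 0) = L2_norm space_measure (\<lambda>x. 0::real)"
    by (rule L2_norm_cong_AE) (use AE_val_0 in auto)
  then have n: "test_norm \<Omega> T (e, val 0) = L2_norm (time_measure T) e"
    using L2_norm_nonneg[of "time_measure T" e] by (simp add: test_norm_def L2_norm_def[of _ "\<lambda>x. 0"])
  have pos: "0 < L2_norm (time_measure T) e" using e0 L2_norm_nonneg[of "time_measure T" e] by linarith
  have "ennreal (\<bar>R (e, val 0)\<bar> / L2_norm (time_measure T) e) \<le> test_dual_norm \<Omega> T R"
    unfolding test_dual_norm_def n[symmetric]
    by (rule SUP_upper) (use e e0 n val_L2 in \<open>auto simp: test_space_def\<close>)
  then have "ennreal (\<bar>R (e, val 0)\<bar> / L2_norm (time_measure T) e) * ennreal (L2_norm (time_measure T) e)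
      \<le> test_dual_norm \<Omega> T R * ennreal (L2_norm (time_measure T) e)"
    by (rule mult_right_mono) simp
  then show ?thesis using pos by (simp add: ennreal_mult[symmetric])
qed

end

section \<open>The error bound\<close>

theorem proposition3p1:
  fixes \<Omega> :: "(real^'d) set" and T :: real and D :: "(real^'p) set"
    and val :: "'v::{real_inner,banach,second_countable_topology} \<Rightarrow> real^'d \<Rightarrow> real"
    and grad :: "'v \<Rightarrow> real^'d \<Rightarrow> real^'d"
    and \<nu> :: "real^'p \<Rightarrow> real \<Rightarrow> real"
    and m\<^sub>a L\<^sub>a :: "real^'p \<Rightarrow> real"
    and g :: "real^'p \<Rightarrow> real \<Rightarrow> 'v \<Rightarrow>\<^sub>L real" and u\<^sub>o :: "real^'d \<Rightarrow> real"
    and K :: nat and \<tau> :: "nat \<Rightarrow> real" and V\<^sub>h V\<^sub>N :: "'v set"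
    and u\<^sub>\<delta> :: "real^'p \<Rightarrow> real \<Rightarrow> 'v" and u u\<^sub>N :: "real \<Rightarrow> 'v"
    and M :: nat and q :: "nat \<Rightarrow> real^'d \<Rightarrow> real" and p :: "nat \<Rightarrow> real^'d"
    and \<mu> :: "real^'p" and \<epsilon>\<^sub>a :: real
  defines "a \<equiv> \<lambda>\<mu>. quasilinear_form \<Omega> val grad (superpose (\<nu> \<mu>))"
    and "a_tilde \<equiv> \<lambda>\<mu>. quasilinear_form \<Omega> val grad (eim_coefficient M q p (\<nu> \<mu>))"
  assumes domain: "open \<Omega>" "connected \<Omega>" "\<Omega> \<noteq> {}" "0 < T" "compact D"
    and V: "H1_subspace \<Omega> val grad"
    and nu_C1: "\<And>\<mu>. \<mu> \<in> D \<Longrightarrow> \<nu> \<mu> C1_differentiable_on UNIV"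
    and A_defined: "\<And>\<mu> u v. \<mu> \<in> D \<Longrightarrow>
      integrable (lebesgue_on \<Omega>) (\<lambda>x. \<nu> \<mu> (val u x) * (grad u x \<bullet> grad v x))"
    and monotone: "\<And>\<mu>. \<mu> \<in> D \<Longrightarrow> strongly_monotone_on UNIV (a \<mu>) (m\<^sub>a \<mu>)"
    and Lipschitz: "\<And>\<mu>. \<mu> \<in> D \<Longrightarrow> Lipschitz_form (a \<mu>) (L\<^sub>a \<mu>)"
    and uniform: "\<exists>c>0. \<forall>\<mu>\<in>D. c \<le> m\<^sub>a \<mu>" "bdd_above (L\<^sub>a ` D)"
    and data: "\<And>\<mu>. \<mu> \<in> D \<Longrightarrow> g \<mu> \<in> L2_space (time_measure T)"
      "u\<^sub>o \<in> L2_space (lebesgue_on \<Omega>)"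
    and grid: "time_grid T K \<tau>"
    and V\<^sub>h: "discrete_space \<Omega> val V\<^sub>h"
    and truth: "\<And>\<mu>. \<mu> \<in> D \<Longrightarrow>
      discrete_solution \<Omega> T val K \<tau> V\<^sub>h (a \<mu>) (g \<mu>) u\<^sub>o (u\<^sub>\<delta> \<mu>)"
    and eim: "eim_construction \<Omega> val D \<nu> K \<tau> u\<^sub>\<delta> M q p"
    and mu: "\<mu> \<in> D"
    and eim_monotone: "0 < \<epsilon>\<^sub>a" "0 < m\<^sub>a \<mu> - \<epsilon>\<^sub>a"
      "strongly_monotone_on V\<^sub>h (a_tilde \<mu>) (m\<^sub>a \<mu> - \<epsilon>\<^sub>a)"
    and exact: "exact_solution \<Omega> T val (a \<mu>) (g \<mu>) u\<^sub>o u"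
    \<comment> \<open>The error of the truth solution is neglected: exchanging \<open>u\<close> for \<open>u\<^sub>\<delta>\<close> has no effect
        in the equation, tested with functions that are discrete in space only.\<close>
    and truth_error_neglected: "\<And>v. v \<in> semidiscrete_test_space T val V\<^sub>h \<Longrightarrow>
      B_form \<Omega> T val (a \<mu>) (u\<^sub>\<delta> \<mu>) v = B_form \<Omega> T val (a \<mu>) u v"
    and V\<^sub>N: "subspace V\<^sub>N" "V\<^sub>N \<subseteq> V\<^sub>h"
    and reduced_basis: "discrete_solution \<Omega> T val K \<tau> V\<^sub>N (a_tilde \<mu>) (g \<mu>) (val (u\<^sub>\<delta> \<mu> 0)) u\<^sub>N"
    and initial: "u\<^sub>\<delta> \<mu> 0 \<in> V\<^sub>N"
  shows "ennreal (trial_test_norm \<Omega> T val (\<lambda>t. u\<^sub>\<delta> \<mu> t - u\<^sub>N t))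
    \<le> ennreal (1 / m\<^sub>a \<mu>) *
        (test_dual_norm \<Omega> T (residual \<Omega> T val (a_tilde \<mu>) (g \<mu>) u\<^sub>N)
         + coefficient_error \<Omega> T val (eim_coefficient M q p (\<nu> \<mu>)) (superpose (\<nu> \<mu>)) u\<^sub>N
           * ennreal (L2_norm (time_measure T) u\<^sub>N))"
proof -
  interpret H1_embedding \<Omega> val grad
    by unfold_locales (rule V)
  have T: "0 < T" by (rule domain)
  define e where "e = (\<lambda>t. u\<^sub>\<delta> \<mu> t - u\<^sub>N t)"
  have V\<^sub>h_sub: "subspace V\<^sub>h" using V\<^sub>h by (simp add: discrete_space_def)
  obtain C where C: "finite_frame C V\<^sub>h" using discrete_space_finite_frame[OF V\<^sub>h] .
  have u\<delta>: "u\<^sub>\<delta> \<mu> \<in> discrete_trial_space T K \<tau> V\<^sub>h"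
    using truth[OF mu] by (simp add: discrete_solution_def)
  have uN: "u\<^sub>N \<in> discrete_trial_space T K \<tau> V\<^sub>N" and uN0: "u\<^sub>N 0 = H_proj \<Omega> val V\<^sub>N (val (u\<^sub>\<delta> \<mu> 0))"
    using reduced_basis by (simp_all add: discrete_solution_def)
  have e0: "e 0 = 0" using H_proj_val_self[OF V\<^sub>N(1) initial] by (simp add: e_def uN0)
  have cu\<delta>: "continuous_on {0..T} (u\<^sub>\<delta> \<mu>)" and cuN: "continuous_on {0..T} u\<^sub>N"
    using u\<delta> uN by (simp_all add: discrete_trial_space_def)
  have ce: "continuous_on {0..T} e" unfolding e_def by (intro continuous_intros cu\<delta> cuN)
  have uN_mem: "u\<^sub>N t \<in> V\<^sub>h" if "t \<in> {0..T}" for t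
  proof (cases "t = 0")
    case True
    then have "u\<^sub>N t = u\<^sub>\<delta> \<mu> 0" using e0 by (simp add: e_def)
    then show ?thesis using initial V\<^sub>N(2) by auto
  next
    case False
    then show ?thesis
      using discrete_trial_space_mem[OF grid V\<^sub>N(1) uN, of t] that V\<^sub>N(2) by auto
  qed
  have e_mem: "e t \<in> V\<^sub>h" if "t \<in> {0<..T}" for t
    using discrete_trial_space_mem[OF grid V\<^sub>h_sub u\<delta> that] uN_mem[of t] that V\<^sub>h_sub
    by (simp add: e_def subspace_diff)

  obtain D\<^sub>\<delta> where D\<delta>: "piecewise_deriv T (\<tau> ` {0..K}) (u\<^sub>\<delta> \<mu>) D\<^sub>\<delta>"
    using discrete_trial_space_piecewise_deriv[OF grid u\<delta>] by blast
  obtain D\<^sub>N where DN: "piecewise_deriv T (\<tau> ` {0..K}) u\<^sub>N D\<^sub>N"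
    using discrete_trial_space_piecewise_deriv[OF grid uN] by blast
  have De: "piecewise_deriv T (\<tau> ` {0..K}) e (\<lambda>t. D\<^sub>\<delta> t - D\<^sub>N t)"
    unfolding e_def by (rule piecewise_deriv_diff[OF D\<delta> DN])

  have \<nu>_cont: "continuous_on UNIV (\<nu> \<mu>)" if "\<mu> \<in> D" for \<mu>
    using C1_differentiable_imp_continuous_on[OF nu_C1[OF that]] .
  note eim_props = eim_basis_properties[OF eim \<nu>_cont]
  have a_int: "integrable space_measure (\<lambda>x. superpose (\<nu> \<mu>) (val u) x * (grad u x \<bullet> grad v x))" for u v
    using A_defined[OF mu] by (simp add: superpose_def)
  have a_tilde_int: "integrable space_measure
      (\<lambda>x. eim_coefficient M q p (\<nu> \<mu>) (val u) x * (grad u x \<bullet> grad v x))" for u v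
    by (rule eim_form_integrable) (use eim_props in auto)
  have a_cont: "continuous_on {0..T} (\<lambda>t. a \<mu> (w t) (w t) (e t))" if "continuous_on {0..T} w" for w
    by (rule Lipschitz_form_continuous_on[OF Lipschitz[OF mu] _ _ that ce])
       (simp_all add: a_def quasilinear_form_0 quasilinear_form_diff[where \<kappa>="superpose (\<nu> \<mu>)", OF a_int])
  have a_tilde_cont: "continuous_on {0..T} (\<lambda>t. a_tilde \<mu> (u\<^sub>N t) (u\<^sub>N t) (e t))"
    unfolding a_tilde_def
    by (rule eim_form_continuous_on[OF _ _ _ \<nu>_cont[OF mu] V\<^sub>h cuN uN_mem ce]) (use eim_props in auto)


  \<comment> \<open>The identity for \<open>R(e)\<close> involves the six integrands below, each integrable on its own.\<close>
  let ?E = "L2_norm (time_measure T) e"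
  let ?v = "(e, val 0)"
  let ?R = "residual \<Omega> T val (a_tilde \<mu>) (g \<mu>) u\<^sub>N"
  let ?du = "\<lambda>t. blinfun_apply (time_deriv \<Omega> T val (u\<^sub>\<delta> \<mu>) t) (e t)"
  let ?dN = "\<lambda>t. blinfun_apply (time_deriv \<Omega> T val u\<^sub>N t) (e t)"
  let ?g = "\<lambda>t. blinfun_apply (g \<mu> t) (e t)"
  let ?a\<delta> = "\<lambda>t. a \<mu> (u\<^sub>\<delta> \<mu> t) (u\<^sub>\<delta> \<mu> t) (e t)"
  let ?aN = "\<lambda>t. a \<mu> (u\<^sub>N t) (u\<^sub>N t) (e t)"
  let ?tN = "\<lambda>t. a_tilde \<mu> (u\<^sub>N t) (u\<^sub>N t) (e t)"
  note pairing = functional_pairing_integrable[OF _ ce C e_mem]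
  have du: "weak_time_deriv \<Omega> T val (u\<^sub>\<delta> \<mu>) (time_deriv \<Omega> T val (u\<^sub>\<delta> \<mu>))"
    by (rule weak_time_deriv_time_deriv[OF T D\<delta>])
  have dN: "weak_time_deriv \<Omega> T val u\<^sub>N (time_deriv \<Omega> T val u\<^sub>N)"
    by (rule weak_time_deriv_time_deriv[OF T DN])
  have ints [simp]: "integrable (time_measure T) ?du" "integrable (time_measure T) ?dN"
    "integrable (time_measure T) ?g" "integrable (time_measure T) ?a\<delta>"
    "integrable (time_measure T) ?aN" "integrable (time_measure T) ?tN"
    using du dN by (auto simp: weak_time_deriv_def
        intro: pairing data(1)[OF mu] continuous_on_integrable_time[OF a_cont[OF cu\<delta>]]
          continuous_on_integrable_time[OF a_cont[OF cuN]] continuous_on_integrable_time[OF a_tilde_cont])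
  have eL2: "e \<in> L2_space (time_measure T)" by (rule continuous_on_L2_space[OF ce])

  \<comment> \<open>The error is affine but in general not constant on the grid intervals, so it is not a discrete
      test function;
      the passage to the exact solution is what allows testing the truth equation with it.\<close>
  have "?v \<in> semidiscrete_test_space T val V\<^sub>h"
    using eL2 e_mem subspace_0[OF V\<^sub>h_sub] by (auto simp: semidiscrete_test_space_def)
  then have "B_form \<Omega> T val (a \<mu>) (u\<^sub>\<delta> \<mu>) ?v = B_form \<Omega> T val (a \<mu>) u ?v"
    by (rule truth_error_neglected)
  also have "?v \<in> test_space \<Omega> T" using eL2 val_L2 by (simp add: test_space_def)
  then have "B_form \<Omega> T val (a \<mu>) u ?v = F_form \<Omega> T (g \<mu>) u\<^sub>o ?v"
    using exact by (simp add: exact_solution_def)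
  finally have truth_e: "(LINT t|time_measure T. ?du t) + (LINT t|time_measure T. ?a\<delta> t)
      = (LINT t|time_measure T. ?g t)"
    by (simp add: B_form_def F_form_def L2_inner_val_0)
  have res: "?R ?v = (LINT t|time_measure T. ?g t) - (LINT t|time_measure T. ?dN t)
      - (LINT t|time_measure T. ?tN t)"
    by (simp add: residual_def)
  have parabolic: "(LINT t|time_measure T. ?dN t) \<le> (LINT t|time_measure T. ?du t)"
  proof -
    have "(LINT t|time_measure T. ?du t) - (LINT t|time_measure T. ?dN t) =
        (LINT t|time_measure T. H_inner (D\<^sub>\<delta> t) (e t)) - (LINT t|time_measure T. H_inner (D\<^sub>N t) (e t))"
      using weak_time_deriv_pairing[OF T D\<delta> du De C e_mem] weak_time_deriv_pairing[OF T DN dN De C e_mem]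
      by simp
    also have "\<dots> = (LINT t|time_measure T. H_inner (D\<^sub>\<delta> t - D\<^sub>N t) (e t))"
      using H_inner_deriv_integrable[OF D\<delta> ce] H_inner_deriv_integrable[OF DN ce]
      by (simp add: H.diff_left)
    also have "\<dots> = (H_inner (e T) (e T) - H_inner (e 0) (e 0)) / 2"
      by (rule energy_identity[OF T De])
    also have "\<dots> \<ge> 0" using H_inner_nonneg[of "e T"] by (simp add: e0 H.zero_left)
    finally show ?thesis by simp
  qed
  have coercive: "m\<^sub>a \<mu> * ?E\<^sup>2 \<le> (LINT t|time_measure T. ?a\<delta> t) - (LINT t|time_measure T. ?aN t)"
  proof -
    have "m\<^sub>a \<mu> * ?E\<^sup>2 = (LINT t|time_measure T. m\<^sub>a \<mu> * (norm (e t))\<^sup>2)"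
      by (simp add: L2_norm_power2)
    also have "\<dots> \<le> (LINT t|time_measure T. ?a\<delta> t - ?aN t)"
    proof (rule integral_mono)
      show "integrable (time_measure T) (\<lambda>t. m\<^sub>a \<mu> * (norm (e t))\<^sup>2)"
        using L2_spaceD(2)[OF eL2] by simp
      show "m\<^sub>a \<mu> * (norm (e t))\<^sup>2 \<le> ?a\<delta> t - ?aN t" for t
        using monotone[OF mu] by (simp add: strongly_monotone_on_def e_def)
    qed simp
    finally show ?thesis by simp
  qed
  let ?\<Delta> = "LINT t|time_measure T. ?tN t - ?aN t"
  have key: "m\<^sub>a \<mu> * ?E\<^sup>2 \<le> \<bar>?R ?v\<bar> + \<bar>?\<Delta>\<bar>"
  proof -
    have "?\<Delta> = (LINT t|time_measure T. ?tN t) - (LINT t|time_measure T. ?aN t)" by simp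
    with truth_e res parabolic coercive show ?thesis by linarith
  qed

  have m_pos: "0 < m\<^sub>a \<mu>" using eim_monotone by linarith
  have norm_e: "trial_test_norm \<Omega> T val (\<lambda>t. u\<^sub>\<delta> \<mu> t - u\<^sub>N t) = ?E"
    using L2_norm_initial_value[OF T ce e0] L2_norm_nonneg[of "time_measure T" e]
    by (simp add: trial_test_norm_def test_norm_def flip: e_def)
  show ?thesis
  proof (cases "?E = 0")
    case True
    then show ?thesis by (simp add: norm_e)
  next
    case False
    let ?\<rho> = "test_dual_norm \<Omega> T ?R"
    let ?\<epsilon> = "coefficient_error \<Omega> T val (eim_coefficient M q p (\<nu> \<mu>)) (superpose (\<nu> \<mu>)) u\<^sub>N"
    have "ennreal \<bar>?\<Delta>\<bar> \<le> ?\<epsilon> * ennreal (L2_norm (time_measure T) u\<^sub>N) * ennreal ?E"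
      unfolding a_def a_tilde_def
    proof (rule coefficient_error_integral[where ?\<kappa>1.0="eim_coefficient M q p (\<nu> \<mu>)" and ?\<kappa>2.0="superpose (\<nu> \<mu>)",
        OF a_tilde_int a_int continuous_on_L2_space[OF cuN] eL2 False])
      show "(\<lambda>t. quasilinear_form \<Omega> val grad (eim_coefficient M q p (\<nu> \<mu>)) (u\<^sub>N t) (u\<^sub>N t) (e t)
        - quasilinear_form \<Omega> val grad (superpose (\<nu> \<mu>)) (u\<^sub>N t) (u\<^sub>N t) (e t)) \<in> borel_measurable (time_measure T)"
        using ints(5,6)[THEN borel_measurable_integrable] unfolding a_def a_tilde_def
        by (rule borel_measurable_diff[rotated])
    qed
    moreover have "ennreal (m\<^sub>a \<mu> * ?E\<^sup>2) \<le> ennreal \<bar>?R ?v\<bar> + ennreal \<bar>?\<Delta>\<bar>"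
      using ennreal_leI[OF key] by simp
    ultimately have "ennreal (m\<^sub>a \<mu> * ?E\<^sup>2) \<le> (?\<rho> + ?\<epsilon> * ennreal (L2_norm (time_measure T) u\<^sub>N)) * ennreal ?E"
      using residual_le_dual_norm[OF eL2 False, of ?R]
      by (simp add: distrib_right) (meson add_mono order_trans)
    moreover have "0 < ?E" using False L2_norm_nonneg[of "time_measure T" e] by linarith
    ultimately show ?thesis unfolding norm_e using m_pos by (intro ennreal_bound_divide)
  qed
qed

end
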